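(* Let $n\ge 1$ and $m\ge 0$ be integers, and let $a:\mathbb{C}^n\to\mathbb{C}$ be a bounded measurable separately radial function. Then the Toeplitz operator $T_a$ acting on $\mathcal{A}^2_m(\mathbb{P}^n(\mathbb{C}))$ is unitarily equivalent to the multiplication operator $\gamma_{a,m}I = R\,T_a\,R^*$ acting on $l_2(J_n(m))$, where $R:\mathcal{A}^2_m(\mathbb{P}^n(\mathbb{C}))\to l_2(J_n(m))$ and $R^*:l_2(J_n(m))\to\mathcal{A}^2_m(\mathbb{P}^n(\mathbb{C}))$ are the mutually inverse isometric isomorphisms $$R:\psi\mapsto\left\{\left(\frac{m!}{p!\,(m-|p|)!}\right)^{1/2}\int_{\mathbb{C}^n}\psi(z)\,\overline{z}^{\,p}\,d\nu_m(z)\right\}_{p\in J_n(m)},\qquad R^*:\{c_p\}_{p\in J_n(m)}\mapsto\sum_{p\in J_n(m)}\left(\frac{m!}{p!\,(m-|p|)!}\right)^{1/2}c_p\,z^p .$$ The sequence $\gamma_{a,m}=\{\gamma_{a,m}(p)\}_{p\in J_n(m)}$ is given explicitly by $$\gamma_{a,m}(p)=\frac{2^n\,(n+m)!}{p!\,(m-|p|)!}\int_{\mathbb{R}^n_+}\frac{a(r_1,\dots,r_n)\,r_1^{2p_1+1}\cdots r_n^{2p_n+1}\,dr_1\cdots dr_n}{(1+r_1^2+\cdots+r_n^2)^{n+m+1}} .$$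
   Context: Let $\nu_m$ be the probability measure on $\mathbb{C}^n$ given by $d\nu_m(z)=\frac{(n+m)!}{\pi^n m!}\frac{dV(z)}{(1+|z_1|^2+\dots+|z_n|^2)^{n+m+1}}$, with $dV$ Lebesgue measure. The weighted Bergman space $\mathcal{A}^2_m(\mathbb{P}^n(\mathbb{C}))$ is the space of global holomorphic sections of the $m$-th tensor power of the hyperplane line bundle over complex projective space; via the trivialization over the affine chart $U_0=\{[w]:w_0\ne0\}\cong\mathbb{C}^n$, $[w]\mapsto(w_1/w_0,\dots,w_n/w_0)$, it is identified with the space of polynomials on $\mathbb{C}^n$ of degree $\le m$, regarded as a closed subspace of $L_2(\mathbb{C}^n,\nu_m)$. Let $B_m$ be the orthogonal projection of $L_2(\mathbb{C}^n,\nu_m)$ onto this subspace. For a bounded measurable symbol $a$ on $\mathbb{C}^n$, the Toeplitz operator is $T_a\psi=B_m(a\psi)$ for $\psi\in\mathcal{A}^2_m(\mathbb{P}^n(\mathbb{C}))$. Notation: $J_n(m)=\{p\in\mathbb{Z}^n: p_j\ge 0 \text{ for all } j,\ |p|\le m\}$, where $|p|=p_1+\cdots+p_n$; $p!=p_1!\cdots p_n!$; $z^p=z_1^{p_1}\cdots z_n^{p_n}$. A function $a$ on $\mathbb{C}^n$ is separately radial if $a(z)=a(r)$, i.e. $a(z)$ depends only on $r=(r_1,\dots,r_n)=(|z_1|,\dots,|z_n|)$. *)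

theory Defs
  imports "HOL-Analysis.Analysis"
begin

section \<open>Spaces of complex-valued functions\<close>

text \<open>
  A Hilbert space is given here by a carrier set of complex-valued functions with an inner
  product, linear in the first argument. For $L_2$ the carrier consists of functions, not of
  almost-everywhere classes. This makes no difference for the Bergman space below: two
  polynomials that agree almost everywhere are equal.
\<close>

definition L2 :: "'a measure \<Rightarrow> ('a \<Rightarrow> complex) set" where
  "L2 M = {f \<in> borel_measurable M. integrable M (\<lambda>x. (cmod (f x))\<^sup>2)}"

definition L2_inner :: "'a measure \<Rightarrow> ('a \<Rightarrow> complex) \<Rightarrow> ('a \<Rightarrow> complex) \<Rightarrow> complex" where
  "L2_inner M f g = (\<integral>x. f x * cnj (g x) \<partial>M)"

text \<open>A family indexed by \<open>X\<close> is represented by its extension by zero.\<close>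

definition l2 :: "'i set \<Rightarrow> ('i \<Rightarrow> complex) set" where
  "l2 X = {c. (\<forall>i. i \<notin> X \<longrightarrow> c i = 0) \<and> (\<lambda>i. (cmod (c i))\<^sup>2) summable_on X}"

definition l2_inner :: "'i set \<Rightarrow> ('i \<Rightarrow> complex) \<Rightarrow> ('i \<Rightarrow> complex) \<Rightarrow> complex" where
  "l2_inner X c d = (\<Sum>\<^sub>\<infinity>i\<in>X. c i * cnj (d i))"

definition isometric_isomorphism ::
  "('a \<Rightarrow> complex) set \<Rightarrow> (('a \<Rightarrow> complex) \<Rightarrow> ('a \<Rightarrow> complex) \<Rightarrow> complex) \<Rightarrow>
   ('b \<Rightarrow> complex) set \<Rightarrow> (('b \<Rightarrow> complex) \<Rightarrow> ('b \<Rightarrow> complex) \<Rightarrow> complex) \<Rightarrow>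
   (('a \<Rightarrow> complex) \<Rightarrow> ('b \<Rightarrow> complex)) \<Rightarrow> bool" where
  "isometric_isomorphism V ipV W ipW U \<longleftrightarrow>
     bij_betw U V W \<and>
     (\<forall>f\<in>V. \<forall>g\<in>V. U (\<lambda>x. f x + g x) = (\<lambda>y. U f y + U g y)) \<and>
     (\<forall>k. \<forall>f\<in>V. U (\<lambda>x. k * f x) = (\<lambda>y. k * U f y)) \<and>
     (\<forall>f\<in>V. \<forall>g\<in>V. ipW (U f) (U g) = ipV f g)"

definition unitarily_equivalent ::
  "('a \<Rightarrow> complex) set \<Rightarrow> (('a \<Rightarrow> complex) \<Rightarrow> ('a \<Rightarrow> complex) \<Rightarrow> complex) \<Rightarrow>
   (('a \<Rightarrow> complex) \<Rightarrow> ('a \<Rightarrow> complex)) \<Rightarrow>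
   ('b \<Rightarrow> complex) set \<Rightarrow> (('b \<Rightarrow> complex) \<Rightarrow> ('b \<Rightarrow> complex) \<Rightarrow> complex) \<Rightarrow>
   (('b \<Rightarrow> complex) \<Rightarrow> ('b \<Rightarrow> complex)) \<Rightarrow> bool" where
  "unitarily_equivalent V ipV S W ipW T \<longleftrightarrow>
     S \<in> V \<rightarrow> V \<and> T \<in> W \<rightarrow> W \<and>
     (\<exists>U. isometric_isomorphism V ipV W ipW U \<and> (\<forall>f\<in>V. U (S f) = T (U f)))"

definition orthogonal_projection ::
  "'a measure \<Rightarrow> ('a \<Rightarrow> complex) set \<Rightarrow> ('a \<Rightarrow> complex) \<Rightarrow> ('a \<Rightarrow> complex)" where
  "orthogonal_projection M V =
     (\<lambda>f\<in>L2 M. THE g. g \<in> V \<and> (\<forall>h\<in>V. L2_inner M (\<lambda>x. f x - g x) h = 0))"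

section \<open>Multi-indices\<close>

definition mi_size :: "nat ^ 'n \<Rightarrow> nat" where
  "mi_size p = (\<Sum>j\<in>UNIV. p $ j)"

definition mi_fact :: "nat ^ 'n \<Rightarrow> real" where
  "mi_fact p = (\<Prod>j\<in>UNIV. fact (p $ j))"

definition mi_power :: "complex ^ 'n \<Rightarrow> nat ^ 'n \<Rightarrow> complex" where
  "mi_power z p = (\<Prod>j\<in>UNIV. (z $ j) ^ (p $ j))"

definition J :: "nat \<Rightarrow> (nat ^ 'n) set" where
  "J m = {p. mi_size p \<le> m}"

section \<open>Bergman spaces and Toeplitz operators on projective space\<close>

definition nu :: "nat \<Rightarrow> (complex ^ 'n) measure" where
  "nu m = density lebesgue (\<lambda>z. ennreal
     (fact (CARD('n) + m) / (pi ^ CARD('n) * fact m) /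
      (1 + (\<Sum>j\<in>UNIV. (cmod (z $ j))\<^sup>2)) ^ (CARD('n) + m + 1)))"

text \<open>
  The holomorphic sections of the $m$-th power of the hyperplane bundle, trivialized over the
  affine chart $w_0 \neq 0$: the polynomial functions of total degree at most $m$.
\<close>

definition bergman_space :: "nat \<Rightarrow> (complex ^ 'n \<Rightarrow> complex) set" where
  "bergman_space m = {\<psi>. \<exists>c. \<psi> = (\<lambda>z. \<Sum>p\<in>J m. c p * mi_power z p)}"

definition bergman_projection ::
  "nat \<Rightarrow> (complex ^ 'n \<Rightarrow> complex) \<Rightarrow> (complex ^ 'n \<Rightarrow> complex)" where
  "bergman_projection m = orthogonal_projection (nu m) (bergman_space m)"

definition toeplitz ::
  "nat \<Rightarrow> (complex ^ 'n \<Rightarrow> complex) \<Rightarrow> (complex ^ 'n \<Rightarrow> complex) \<Rightarrow> (complex ^ 'n \<Rightarrow> complex)" where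
  "toeplitz m a \<psi> = bergman_projection m (\<lambda>z. a z * \<psi> z)"

definition separately_radial :: "(complex ^ 'n \<Rightarrow> complex) \<Rightarrow> bool" where
  "separately_radial a \<longleftrightarrow> (\<forall>z. a z = a (\<chi> j. complex_of_real (cmod (z $ j))))"

definition R :: "nat \<Rightarrow> (complex ^ 'n \<Rightarrow> complex) \<Rightarrow> (nat ^ 'n \<Rightarrow> complex)" where
  "R m \<psi> = (\<lambda>p. if p \<in> J m then
      complex_of_real (sqrt (fact m / (mi_fact p * fact (m - mi_size p)))) *
      (\<integral>z. \<psi> z * mi_power (\<chi> j. cnj (z $ j)) p \<partial>nu m)
    else 0)"

definition R_star :: "nat \<Rightarrow> (nat ^ 'n \<Rightarrow> complex) \<Rightarrow> (complex ^ 'n \<Rightarrow> complex)" where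
  "R_star m c = (\<lambda>z. \<Sum>p\<in>J m.
      complex_of_real (sqrt (fact m / (mi_fact p * fact (m - mi_size p)))) * c p * mi_power z p)"

definition gamma :: "(complex ^ 'n \<Rightarrow> complex) \<Rightarrow> nat \<Rightarrow> nat ^ 'n \<Rightarrow> complex" where
  "gamma a m p =
     complex_of_real (2 ^ CARD('n) * fact (CARD('n) + m) / (mi_fact p * fact (m - mi_size p))) *
     (LINT r : {r :: real ^ 'n. \<forall>j. 0 \<le> r $ j} | lebesgue.
        a (\<chi> j. complex_of_real (r $ j)) *
        complex_of_real ((\<Prod>j\<in>UNIV. (r $ j) ^ (2 * (p $ j) + 1)) /
          (1 + (\<Sum>j\<in>UNIV. (r $ j)\<^sup>2)) ^ (CARD('n) + m + 1)))"

definition mult_op :: "('i \<Rightarrow> complex) \<Rightarrow> ('i \<Rightarrow> complex) \<Rightarrow> ('i \<Rightarrow> complex)" where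
  "mult_op g c = (\<lambda>i. g i * c i)"

end

theory Submission
  imports Defs
begin

text \<open>
  Since \<open>a\<close> and \<open>nu m\<close> are invariant under rotating each coordinate, distinct monomials are
  orthogonal in \<open>L2 (nu m)\<close>, and remain so after multiplication by \<open>a\<close>. Hence \<open>T\<^sub>a\<close> is
  diagonal in the basis of normalized monomials, and \<open>R\<close> is the passage to coordinates in that
  basis. Polar coordinates in each variable give the eigenvalues \<open>gamma a m p\<close>; the norms of the
  monomials are Dirichlet integrals. As \<open>a\<close> is only Lebesgue measurable, one needs that its
  restriction to the real points is Lebesgue measurable and agrees almost everywhere with a Borel
  function \<open>b\<close> such that \<open>a z = b \<bar>z\<bar>\<close> almost everywhere.
\<close>

section \<open>Lebesgue measure on powers of a Euclidean space\<close>

text \<open>The real points of \<open>complex ^ 'n\<close> form a Lebesgue null set, so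
  measurability of \<open>a\<close> by itself says nothing about its values there, yet
  \<open>gamma\<close> integrates exactly these values. Radiality repairs this: a set of positive
  modulus vectors whose preimage in \<open>complex ^ 'n\<close> is Lebesgue measurable is itself
  Lebesgue measurable. The boundary of the orthant escapes this argument, but the polar density
  vanishes there.

  The Hilbert space facts all rest on one sesquilinear identity, the integral of \<open>a\<close>
  times \<open>R_star m c\<close> times the conjugate of \<open>R_star m d\<close>. The symbol 1
  shows that \<open>R_star\<close> is isometric, a general symbol gives the matrix of the Toeplitz
  operator, and integrability for the symbol |a|^2 puts \<open>a\<close> times a polynomial into L2.

  Constants: the circles contribute (2 pi)^n, whose pi^n cancels the one in \<open>nu\<close>,
  leaving 2^n (n+m)! / m!. Dividing by the squared norm p! (m-|p|)! / m! of the monomial gives the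
  factor in \<open>gamma\<close>.\<close>

lemma borel_measurable_vec_lambda [measurable]:
  fixes f :: "'n::finite \<Rightarrow> 'a \<Rightarrow> 'b::euclidean_space"
  assumes "\<And>j. f j \<in> borel_measurable M"
  shows "(\<lambda>x. \<chi> j. f j x) \<in> borel_measurable M"
  unfolding borel_measurable_euclidean_space[where f = "\<lambda>x. \<chi> j. f j x"]
  using assms by (auto simp: Basis_vec_def inner_axis)

lemma borel_measurable_vec_nth [measurable]:
  "(\<lambda>z :: 'a::euclidean_space ^ 'n. z $ j) \<in> borel_measurable borel"
  by (intro borel_measurable_continuous_onI continuous_intros)

text \<open>Both measures give a box the product of its side lengths, because the basis of the power
  consists of one copy of \<open>Basis\<close> per coordinate. The factor is an arbitrary Euclidean
  space since both \<open>complex ^ 'n\<close> and \<open>real ^ 'n\<close> occur below.\<close>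

lemma lborel_vec_eq_PiM:
  "(lborel :: ('a::euclidean_space ^ 'n::finite) measure) =
     distr (\<Pi>\<^sub>M j\<in>UNIV. lborel) borel (\<lambda>f. \<chi> j. f j)"
proof (rule lborel_eqI)
  interpret product_sigma_finite "\<lambda>_::'n. lborel :: 'a measure" ..
  have meas: "(\<lambda>f. \<chi> j. f j) \<in> (\<Pi>\<^sub>M j\<in>(UNIV::'n set). (lborel::'a measure)) \<rightarrow>\<^sub>M borel"
    by (intro borel_measurable_vec_lambda) simp
  fix l u :: "'a ^ 'n"
  assume le: "\<And>b. b \<in> Basis \<Longrightarrow> l \<bullet> b \<le> u \<bullet> b"
  then have le': "(l $ j) \<bullet> b \<le> (u $ j) \<bullet> b" if "b \<in> Basis" for j b
    using that le[of "axis j b"] by (auto simp: Basis_vec_def inner_axis)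
  have "(\<lambda>f. \<chi> j. f j) -` box l u \<inter> space (\<Pi>\<^sub>M j\<in>(UNIV::'n set). (lborel::'a measure))
      = (\<Pi>\<^sub>E j\<in>UNIV. box (l $ j) (u $ j))"
    by (auto simp: space_PiM mem_box Basis_vec_def inner_axis PiE_def Pi_iff)
  then have "emeasure (distr (\<Pi>\<^sub>M j\<in>UNIV. lborel) borel (\<lambda>f. \<chi> j. f j)) (box l u)
      = (\<Prod>j\<in>UNIV. emeasure lborel (box (l $ j) (u $ j)))"
    by (simp add: emeasure_distr[OF meas] emeasure_PiM)
  also have "\<dots> = (\<Prod>j\<in>UNIV. \<Prod>b\<in>Basis. ((u $ j - l $ j) \<bullet> b))"
    using le' by (simp add: prod_ennreal emeasure_lborel_box prod_nonneg inner_diff_left)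
  also have "(\<Prod>j\<in>UNIV. \<Prod>b\<in>Basis. ((u $ j - l $ j) \<bullet> b))
      = (\<Prod>(j, b)\<in>UNIV \<times> Basis. ((u $ j - l $ j) \<bullet> b))"
    by (simp add: prod.cartesian_product)
  also have "\<dots> = (\<Prod>b\<in>Basis. (u - l) \<bullet> b)"
  proof -
    have B: "(Basis :: ('a ^ 'n) set) = (\<lambda>(j, b). axis j b) ` (UNIV \<times> Basis)"
      by (auto simp: Basis_vec_def)
    have inj: "inj_on (\<lambda>(j, b). axis j b :: 'a ^ 'n) (UNIV \<times> Basis)"
      by (auto simp: inj_on_def axis_eq_axis)
    show ?thesis
      unfolding B prod.reindex[OF inj] by (simp add: inner_axis split_beta)
  qed
  finally show "emeasure (distr (\<Pi>\<^sub>M j\<in>UNIV. lborel) borel (\<lambda>f. \<chi> j. f j)) (box l u)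
      = (\<Prod>b\<in>Basis. (u - l) \<bullet> b)" .
qed simp

lemma nn_integral_lborel_vec_prod:
  fixes f :: "'n::finite \<Rightarrow> 'a::euclidean_space \<Rightarrow> ennreal"
  assumes [measurable]: "\<And>j. f j \<in> borel_measurable borel"
  shows "(\<integral>\<^sup>+z. (\<Prod>j\<in>UNIV. f j (z $ j)) \<partial>(lborel :: ('a ^ 'n) measure))
      = (\<Prod>j\<in>UNIV. \<integral>\<^sup>+x. f j x \<partial>lborel)"
proof -
  interpret product_sigma_finite "\<lambda>_::'n. lborel :: 'a measure" ..
  show ?thesis
    unfolding lborel_vec_eq_PiM
    by (subst nn_integral_distr) (auto simp: product_nn_integral_prod)
qed

lemma emeasure_lborel_vec:
  fixes A :: "'n::finite \<Rightarrow> 'a::euclidean_space set"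
  assumes [measurable]: "\<And>j. A j \<in> sets borel"
  shows "emeasure lborel {z. \<forall>j. z $ j \<in> A j} = (\<Prod>j\<in>UNIV. emeasure lborel (A j))"
proof -
  have ind: "indicator {z. \<forall>j. z $ j \<in> A j} z = (\<Prod>j\<in>UNIV. indicator (A j) (z $ j) :: ennreal)" for z
    by (auto simp: indicator_def prod_zero_iff)
  have "emeasure lborel {z. \<forall>j. z $ j \<in> A j} = (\<integral>\<^sup>+z. indicator {z. \<forall>j. z $ j \<in> A j} z \<partial>lborel)"
    by (intro nn_integral_indicator[symmetric]) simp
  also have "\<dots> = (\<Prod>j\<in>UNIV. emeasure lborel (A j))"
    unfolding ind by (subst nn_integral_lborel_vec_prod) auto
  finally show ?thesis .
qed

section \<open>Rotation invariance of Lebesgue measure\<close>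

lemma lborel_complex_eq_distr_vec2:
  "distr lborel borel (\<lambda>v :: real ^ 2. Complex (v $ 1) (v $ 2)) = lborel"
proof (rule lborel_eqI[symmetric])
  have [measurable]: "(\<lambda>v :: real ^ 2. Complex (v $ 1) (v $ 2)) \<in> borel_measurable borel"
    by (intro borel_measurable_continuous_onI) (simp add: Complex_eq continuous_intros)
  fix l u :: complex
  assume le: "\<And>b. b \<in> Basis \<Longrightarrow> l \<bullet> b \<le> u \<bullet> b"
  have "(\<lambda>v :: real ^ 2. Complex (v $ 1) (v $ 2)) -` box l u = box (\<chi> j. if j
      = 1 then Re l else Im l) (\<chi> j. if j = 1 then Re u else Im u)"
    by (auto simp: mem_box Basis_vec_def Basis_complex_def inner_axis forall_2)
  then show "emeasure (distr lborel borel (\<lambda>v :: real ^ 2. Complex (v $ 1) (v $ 2))) (box l u)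
      = (\<Prod>b\<in>Basis. (u - l) \<bullet> b)"
    using le[of 1] le[of \<i>] by
        (auto simp: emeasure_distr Basis_complex_def emeasure_lborel_box_eq Basis_vec_def
            inner_axis UNIV_2 axis_eq_axis
       inner_diff_left)
qed simp

text \<open>The preimage of a box is its image under the inverse map, which is again orthogonal and
  hence preserves the measure of the box.\<close>

lemma lborel_distr_orthogonal_transformation:
  fixes f :: "real ^ 'n::{finite,wellorder} \<Rightarrow> real ^ 'n::_"
  assumes f: "orthogonal_transformation f"
  shows "distr lborel borel f = lborel"
proof (rule lborel_eqI[symmetric])
  have [measurable]: "f \<in> borel_measurable borel"
    using orthogonal_transformation_linear[OF f]
    by (intro borel_measurable_continuous_onI linear_continuous_on)
       (rule linear_conv_bounded_linear[THEN iffD1])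
  fix l u :: "real ^ 'n::_"
  assume le: "\<And>b. b \<in> Basis \<Longrightarrow> l \<bullet> b \<le> u \<bullet> b"
  have inv: "orthogonal_transformation (inv f)"
    using f by (rule orthogonal_transformation_inv)
  have img: "f -` box l u = inv f ` box l u"
    using f by (simp add: bij_vimage_eq_inv_image orthogonal_transformation_bij)
  have "f -` box l u \<in> sets borel"
    using measurable_sets[of f borel borel "box l u"] by simp
  then have "emeasure (distr lborel borel f) (box l u) = emeasure lebesgue (inv f ` box l u)"
    by (simp add: emeasure_distr flip: img)
  also have "\<dots> = measure lebesgue (inv f ` box l u)"
    by (intro emeasure_eq_measure2 measurable_orthogonal_image inv) simp
  also have "\<dots> = measure lborel (box l u)"
    by (simp add: measure_orthogonal_image inv)
  also have "\<dots> = (\<Prod>b\<in>Basis. (u - l) \<bullet> b)"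
    using le by simp
  finally show "emeasure (distr lborel borel f) (box l u) = (\<Prod>b\<in>Basis. (u - l) \<bullet> b)" .
qed simp

lemma lborel_distr_rotation:
  fixes c :: complex
  assumes "cmod c = 1"
  shows "distr lborel borel ((*) c) = lborel"
proof -
  \<comment> \<open>\<open>h\<close> identifies \<open>real ^ 2\<close> with the plane, and
    \<open>f\<close> is the matrix of multiplication by \<open>c\<close> in these coordinates. It is
    orthogonal because \<open>c\<close> has modulus 1.\<close>
  define h where "h = (\<lambda>v :: real ^ 2. Complex (v $ 1) (v $ 2))"
  define f where "f = (\<lambda>v :: real ^ 2.
    (\<chi> j. if j = 1 then Re c * v $ 1 - Im c * v $ 2 else Im c * v $ 1 + Re c * v $ 2) :: real ^ 2)"
  have c: "(Re c)\<^sup>2 + (Im c)\<^sup>2 = 1"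
    using assms by (simp add: cmod_power2[symmetric])
  have "linear f"
    by (rule linearI) (auto simp: f_def vec_eq_iff algebra_simps)
  moreover have "f v \<bullet> f v = v \<bullet> v" for v
  proof -
    have "f v \<bullet> f v = ((Re c)\<^sup>2 + (Im c)\<^sup>2) * (v \<bullet> v)"
      by (simp add: f_def inner_vec_def UNIV_2 power2_eq_square algebra_simps)
    then show ?thesis by (simp add: c)
  qed
  ultimately have f: "orthogonal_transformation f"
    by (simp add: orthogonal_transformation norm_eq_sqrt_inner)
  have [measurable]: "f \<in> borel_measurable borel"
    unfolding f_def by (intro borel_measurable_vec_lambda) auto
  have [measurable]: "h \<in> borel_measurable borel"
    unfolding h_def by (intro borel_measurable_continuous_onI)
        (simp add: Complex_eq continuous_intros)
  have h: "lborel = distr lborel borel h"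
    by (simp add: h_def lborel_complex_eq_distr_vec2)
  have "distr lborel borel ((*) c) = distr (distr lborel borel h) borel ((*) c)"
    using h by simp
  also have "\<dots> = distr lborel borel ((*) c \<circ> h)"
    by (intro distr_distr) auto
  also have "(*) c \<circ> h = h \<circ> f"
    by (auto simp: h_def f_def fun_eq_iff complex_eq_iff)
  also have "distr lborel borel (h \<circ> f) = distr (distr lborel borel f) borel h"
    by (intro distr_distr[symmetric]) auto
  also have "\<dots> = lborel"
    by (simp add: lborel_distr_orthogonal_transformation[OF f] flip: h)
  finally show ?thesis .
qed

text \<open>The preimage of a box is a product of plane sets in which only the factor
  \<open>k\<close> is turned. That factor is no longer a box, so \<open>emeasure_lborel_vec\<close>
  is applied with general Borel factors. One coordinate is enough later, because distinct
  multi-indices differ in some coordinate.\<close>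

lemma lborel_distr_rotation_coord:
  fixes c :: complex and k :: "'n::finite"
  assumes "cmod c = 1"
  shows "distr lborel borel (\<lambda>z :: complex ^ 'n. \<chi> j. if j = k then c * z $ j else z $ j) = lborel"
proof (rule lborel_eqI[symmetric])
  fix l u :: "complex ^ 'n"
  assume le: "\<And>b. b \<in> Basis \<Longrightarrow> l \<bullet> b \<le> u \<bullet> b"
  let ?A = "\<lambda>j. if j = k then (*) c -` box (l $ j) (u $ j) else box (l $ j) (u $ j)"
  have m: "(*) c -` box (l $ j) (u $ j) \<in> sets borel" for j
    using measurable_sets[of "(*) c" borel borel "box (l $ j) (u $ j)"] by simp
  have "emeasure lborel ((*) c -` box (l $ k) (u $ k))
      = emeasure (distr lborel borel ((*) c)) (box (l $ k) (u $ k))"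
    by (simp add: emeasure_distr)
  then have A: "emeasure lborel (?A j) = emeasure lborel (box (l $ j) (u $ j))" for j
    by (simp add: lborel_distr_rotation[OF assms])
  have "emeasure (distr lborel borel (\<lambda>z :: complex ^ 'n. \<chi> j. if j
      = k then c * z $ j else z $ j)) (box l u)
     = emeasure lborel {z. \<forall>j. z $ j \<in> ?A j}"
    by (subst emeasure_distr)
       (auto intro!: arg_cong[where f = "emeasure lborel"] Collect_cong
             simp: mem_box Basis_vec_def inner_axis vimage_def)
  also have "\<dots> = (\<Prod>j\<in>UNIV. emeasure lborel (box (l $ j) (u $ j)))"
    using m by (subst emeasure_lborel_vec) (simp_all only: A, auto)
  also have "\<dots> = emeasure lborel {z. \<forall>j. z $ j \<in> box (l $ j) (u $ j)}"
    by (simp add: emeasure_lborel_vec)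
  also have "{z. \<forall>j. z $ j \<in> box (l $ j) (u $ j)} = box l u"
    by (auto simp: mem_box Basis_vec_def inner_axis)
  finally show "emeasure (distr lborel borel (\<lambda>z :: complex ^ 'n. \<chi> j. if j
      = k then c * z $ j else z $ j)) (box l u)
      = (\<Prod>b\<in>Basis. (u - l) \<bullet> b)"
    using le by (simp add: emeasure_lborel_box)
qed simp

section \<open>Polar coordinates in each variable\<close>

definition modulus :: "complex ^ 'n \<Rightarrow> real ^ 'n" where
  "modulus z = (\<chi> j. cmod (z $ j))"

lemma modulus_nth [simp]: "modulus z $ j = cmod (z $ j)"
  by (simp add: modulus_def)

lemma continuous_on_modulus: "continuous_on S modulus"
  unfolding modulus_def by (intro continuous_intros)

lemma borel_measurable_modulus [measurable]: "modulus \<in> borel_measurable borel"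
  by (intro borel_measurable_continuous_onI continuous_on_modulus)

text \<open>The antiderivative of 2 pi r is pi r^2. Using \<open>max 0 r\<close> and
  \<open>{..s}\<close> makes the equation valid for negative \<open>s\<close> too, where the disc is
  empty; this form matches the lower orthants in \<open>distr_modulus\<close>.\<close>

lemma nn_integral_circumference:
  "(\<integral>\<^sup>+r. ennreal (2 * pi * max 0 r) * indicator {..s} r \<partial>lborel)
      = emeasure lborel (cball (0 :: complex) s)"
proof (cases "s \<ge> 0")
  case True
  have "(\<integral>\<^sup>+r. ennreal (2 * pi * max 0 r) * indicator {..s} r \<partial>lborel)
      = (\<integral>\<^sup>+r. ennreal (2 * pi * r) * indicator {0..s} r \<partial>lborel)"
    by (intro nn_integral_cong) (auto simp: indicator_def max_def)
  also have "\<dots> = ennreal (pi * s\<^sup>2 - pi * 0\<^sup>2)"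
    using True by (intro nn_integral_FTC_Icc) (auto intro!: derivative_eq_intros)
  finally show ?thesis
    using True by (simp add: emeasure_cball unit_ball_vol_2)
next
  case False
  then have "(\<integral>\<^sup>+r. ennreal (2 * pi * max 0 r) * indicator {..s} r \<partial>lborel)
      = (\<integral>\<^sup>+(r::real). 0 \<partial>lborel)"
    by (intro nn_integral_cong) (auto simp: indicator_def max_def)
  with False show ?thesis by simp
qed

text \<open>Lower orthants form an intersection-stable generator, and the preimage of
  \<open>{..s}\<close> is a polydisc, whose volume is a product of disc areas. The factor 2 pi in
  each variable is the integrated angle.\<close>

lemma distr_modulus:
  "distr lborel borel modulus =
     density lborel (\<lambda>r :: real ^ 'n. ennreal (\<Prod>j\<in>UNIV. 2 * pi * max 0 (r $ j)))"
proof (rule measure_eqI_generator_eq[where \<Omega> = UNIV and E = "range atMost"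
      and A = "\<lambda>i. {..(\<chi> j. real i)}"])
  show "Int_stable (range (atMost :: real ^ 'n \<Rightarrow> _))"
  proof -
    have "{..a} \<inter> {..b} = {..inf a b}" for a b :: "real ^ 'n" by auto
    then show ?thesis by (auto simp: Int_stable_def)
  qed
  fix X :: "(real ^ 'n) set" assume "X \<in> range atMost"
  then obtain s where X: "X = {..s}" by auto
  have "emeasure (distr lborel borel modulus) X
      = emeasure lborel {z :: complex ^ 'n. \<forall>j. z $ j \<in> cball 0 (s $ j)}"
    by (subst emeasure_distr) (auto simp: X less_eq_vec_def intro!: arg_cong[where f
        = "emeasure lborel"])
  also have "\<dots> = (\<Prod>j\<in>UNIV. \<integral>\<^sup>+r. ennreal (2 * pi * max 0 r) * indicator {..s $ j} r \<partial>lborel)"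
    by (subst emeasure_lborel_vec) (auto simp: nn_integral_circumference)
  also have "\<dots> = (\<integral>\<^sup>+r. (\<Prod>j\<in>UNIV. ennreal (2 * pi * max 0 (r $ j))
      * indicator {..s $ j} (r $ j)) \<partial>lborel)"
    by (subst nn_integral_lborel_vec_prod) auto
  also have "\<dots> = (\<integral>\<^sup>+r. ennreal (\<Prod>j\<in>UNIV. 2 * pi * max 0 (r $ j)) * indicator X r \<partial>lborel)"
    by (intro nn_integral_cong)
       (auto simp: prod_ennreal X indicator_def less_eq_vec_def prod.distrib prod_zero_iff)
  also have "\<dots> = emeasure (density lborel (\<lambda>r :: real ^ 'n. ennreal (\<Prod>j\<in>UNIV. 2 * pi
      * max 0 (r $ j)))) X"
    by (subst emeasure_density) (auto simp: X)
  finally show "emeasure (distr lborel borel modulus) X = \<dots>" .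
next
  show "(\<Union>i. {..(\<chi> j. real i) :: real ^ 'n}) = UNIV"
  proof safe
    fix x :: "real ^ 'n"
    obtain i :: nat where "Max (range (($) x)) \<le> real i"
      using real_arch_simple by blast
    then show "x \<in> (\<Union>i. {..(\<chi> j. real i)})"
      by (auto simp: less_eq_vec_def)
  qed simp
  fix i :: nat
  have "emeasure (distr lborel borel modulus) {..(\<chi> j. real i) :: real ^ 'n}
      = emeasure lborel {z :: complex ^ 'n. \<forall>j. z $ j \<in> cball 0 (real i)}"
    by (subst emeasure_distr) (auto simp: less_eq_vec_def intro!: arg_cong[where f
        = "emeasure lborel"])
  then show "emeasure (distr lborel borel modulus) {..(\<chi> j. real i) :: real ^ 'n} \<noteq> \<infinity>"
    by (subst (asm) emeasure_lborel_vec) (auto simp: emeasure_cball prod_ennreal ennreal_power)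
qed (auto simp: borel_eq_atMost)

text \<open>The density in \<open>distr_modulus\<close> is positive exactly on the open orthant, so
  there the pushforward and Lebesgue measure have the same null sets. One direction shows that a set
  of moduli is null, the other lifts an exceptional set back to \<open>complex ^ 'n\<close>.\<close>

lemma AE_modulus_iff:
  assumes [measurable]: "Measurable.pred borel P"
  shows "(AE z in lborel. P (modulus z)) \<longleftrightarrow> (AE r :: real ^ 'n in lborel. (\<forall>j. 0 < r $ j) \<longrightarrow> P r)"
proof -
  have pos: "0 < (\<Prod>j\<in>UNIV. 2 * pi * max 0 (r $ j)) \<longleftrightarrow> (\<forall>j. 0 < r $ j)" for r :: "real ^ 'n"
  proof
    assume *: "0 < (\<Prod>j\<in>UNIV. 2 * pi * max 0 (r $ j))"
    show "\<forall>j. 0 < r $ j"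
    proof (rule ccontr)
      assume "\<not> (\<forall>j. 0 < r $ j)"
      then obtain j where "max 0 (r $ j) = 0" by (meson max_absorb1 not_less)
      then have "(\<Prod>j\<in>UNIV. 2 * pi * max 0 (r $ j)) = 0"
        by (intro prod_zero) auto
      with * show False by simp
    qed
  qed (auto intro!: prod_pos)
  have "(AE z in lborel. P (modulus z)) \<longleftrightarrow> (AE r in distr lborel borel modulus. P r)"
    by (subst AE_distr_iff) auto
  also have "\<dots> \<longleftrightarrow> (AE r :: real ^ 'n in lborel. 0 < ennreal (\<Prod>j\<in>UNIV. 2 * pi * max 0 (r $ j)) \<longrightarrow> P r)"
    unfolding distr_modulus by (intro AE_density) simp
  finally show ?thesis by (simp only: ennreal_less_zero_iff pos)
qed

text \<open>Up to a null set, a Lebesgue set is a countable union of compact sets, and so is its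
  complement; the images of these compact sets sandwich \<open>P\<close>.\<close>

lemma sets_lebesgue_vimage_modulus:
  fixes P :: "(real ^ 'n) set"
  assumes pos: "P \<subseteq> {r. \<forall>j. 0 < r $ j}" and Q: "modulus -` P \<in> sets lebesgue"
  shows "P \<in> sets lebesgue"
proof -
  obtain C T where C: "fsigma C" "T \<in> null_sets lebesgue" "C \<union> T = modulus -` P"
    using lebesgue_set_almost_fsigma[OF Q] by metis
  have "- (modulus -` P) \<in> sets lebesgue"
    using Q by (simp add: Compl_in_sets_lebesgue)
  then obtain C' T' where C': "fsigma C'" "T' \<in> null_sets lebesgue" "C' \<union> T' = - (modulus -` P)"
    using lebesgue_set_almost_fsigma by metis
  \<comment> \<open>The image of a Borel set under a continuous map need not be Borel, but the image
    of a compact set is compact. This is why the approximation from inside uses countable unions of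
    compact sets.\<close>
  have image: "modulus ` S \<in> sets borel" if "fsigma S" for S :: "(complex ^ 'n) set"
  proof -
    from that obtain F :: "nat \<Rightarrow> _" where F: "range F \<subseteq> Collect compact" "S = \<Union> (range F)"
      by (auto simp: fsigma_Union_compact)
    have "modulus ` F i \<in> sets borel" for i
      using F by (intro borel_compact compact_continuous_image continuous_on_modulus) auto
    then show ?thesis
      unfolding F(2) image_UN by blast
  qed
  \<comment> \<open>\<open>D\<close> collects the positive vectors reached from neither
    \<open>C\<close> nor \<open>C'\<close>. Every point above \<open>D\<close> lies in
    \<open>T\<close> or \<open>T'\<close>, so \<open>D\<close> is null.\<close>
  define D where "D = {r. \<forall>j. 0 < r $ j} - modulus ` C - modulus ` C'"
  have [measurable]: "D \<in> sets borel"
    unfolding D_def using image C(1) C'(1) by (intro sets.Diff) auto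
  have "AE z in lebesgue. z \<notin> T \<union> T'"
    using C(2) C'(2) by (intro AE_not_in) auto
  moreover have "modulus z \<notin> D" if "z \<notin> T \<union> T'" for z
    using that C(3) C'(3) unfolding D_def by blast
  ultimately have "AE z in lebesgue. modulus z \<notin> D"
    by (auto elim: eventually_mono)
  then have "AE z in lborel. modulus z \<notin> D"
    by (subst (asm) AE_completion_iff)
  then have "AE r in lborel. (\<forall>j. 0 < r $ j) \<longrightarrow> r \<notin> D"
    by (subst (asm) AE_modulus_iff) auto
  then have "AE r in lborel. r \<notin> D"
    by (rule eventually_mono) (auto simp: D_def)
  then have D: "D \<in> null_sets lborel"
    by (subst (asm) AE_iff_null_sets[symmetric]) auto
  \<comment> \<open>A point of \<open>P\<close> outside the image of \<open>C\<close> is not in the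
    image of \<open>C'\<close> either, since \<open>C'\<close> lies above the complement of
    \<open>P\<close>; hence it is in \<open>D\<close>. The possibly irregular part of
    \<open>P\<close> inside \<open>D\<close> is measurable by completeness.\<close>
  have "P = modulus ` C \<union> (P \<inter> D)"
    using pos C(3) C'(3) unfolding D_def by blast
  moreover have "P \<inter> D \<in> null_sets lebesgue"
    using D null_sets_completion_subset[of "P \<inter> D" D lborel] null_sets_completionI by blast
  ultimately show ?thesis
    using image[OF C(1)] by (metis null_setsD2 sets.Un sets_completionI_sets sets_lborel)
qed

lemma completion_ex_borel_measurable_complex:
  fixes g :: "'a \<Rightarrow> complex"
  assumes g: "g \<in> borel_measurable (completion M)"
  obtains g' where "g' \<in> borel_measurable M" "AE x in M. g x = g' x"
proof -
  have "(\<lambda>x. Re (g x)) \<in> borel_measurable (completion M)" "(\<lambda>x. Im (g x)) \<in> borel_measurable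
      (completion M)"
    using g by auto
  then obtain u v where [measurable]: "u \<in> borel_measurable M" "v \<in> borel_measurable M"
    and uv: "AE x in M. Re (g x) = u x" "AE x in M. Im (g x) = v x"
    using completion_ex_borel_measurable_real by blast
  from uv have "AE x in M. g x = complex_of_real (u x) + \<i> * complex_of_real (v x)"
    by eventually_elim (simp add: complex_eq_iff)
  then show thesis by (intro that[of "\<lambda>x. complex_of_real (u x) + \<i> * complex_of_real (v x)"]) auto
qed

text \<open>One Borel function \<open>b\<close> has to serve both sides: it replaces
  \<open>a\<close> on real points in \<open>gamma\<close>, and \<open>b\<close> composed with
  \<open>modulus\<close> replaces \<open>a\<close> in the integrals over
  \<open>complex ^ 'n\<close>.\<close>

lemma separately_radial_representation:
  fixes a :: "complex ^ 'n \<Rightarrow> complex"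
  assumes a: "a \<in> borel_measurable lebesgue" and rad: "separately_radial a"
  obtains b where "b \<in> borel_measurable borel"
    and "AE r in lborel. (\<forall>j. 0 < r $ j) \<longrightarrow> a (\<chi> j. complex_of_real (r $ j)) = b r"
    and "AE z in lborel. a z = b (modulus z)"
proof -
  let ?pos = "\<lambda>r :: real ^ 'n. \<forall>j. 0 < r $ j"
  \<comment> \<open>The value 0 off the open orthant changes a preimage under \<open>b0\<close> only
    by the Borel set of vectors that are not positive.\<close>
  define b0 where "b0 r = (if ?pos r then a (\<chi> j. complex_of_real (r $ j)) else 0)" for r
  have a_mod: "a (\<chi> j. complex_of_real (cmod (z $ j))) = a z" for z
    using rad by (simp add: separately_radial_def)
  have "b0 \<in> borel_measurable lebesgue"
  proof (rule measurableI)
    fix S :: "complex set" assume S: "S \<in> sets borel"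
    define P where "P = {r. ?pos r \<and> a (\<chi> j. complex_of_real (r $ j)) \<in> S}"
    have "{z :: complex ^ 'n. \<forall>j. 0 < cmod (z $ j)} \<in> sets borel" by measurable
    then have "{z :: complex ^ 'n. \<forall>j. 0 < cmod (z $ j)} \<in> sets lebesgue" by auto
    moreover have "a -` S \<in> sets lebesgue"
      using measurable_sets[OF a S] by simp
    \<comment> \<open>Radiality turns the condition on the real point with the moduli of
      \<open>z\<close> into the condition that \<open>a z\<close> lies in \<open>S\<close>.\<close>
    moreover have "modulus -` P = {z. \<forall>j. 0 < cmod (z $ j)} \<inter> a -` S"
      by (auto simp: P_def a_mod)
    ultimately have "modulus -` P \<in> sets lebesgue" by auto
    then have P: "P \<in> sets lebesgue"
      by (rule sets_lebesgue_vimage_modulus[rotated]) (auto simp: P_def)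
    have "{r. \<not> ?pos r} \<in> sets borel" by measurable
    then have N: "{r. \<not> ?pos r} \<in> sets lebesgue" by auto
    have "b0 -` S \<inter> space lebesgue = P \<union> (if 0 \<in> S then {r. \<not> ?pos r} else {})"
      by (auto simp: b0_def P_def split: if_splits)
    then show "b0 -` S \<inter> space lebesgue \<in> sets lebesgue"
      by (cases "0 \<in> S") (use P sets.Un[OF P N] in simp_all)
  qed simp
  then obtain b where [measurable]: "b \<in> borel_measurable lborel" and b: "AE r in lborel. b0 r
      = b r"
    by (rule completion_ex_borel_measurable_complex)
  \<comment> \<open>The exceptional set is enlarged to a Borel null set, because
    \<open>AE_modulus_iff\<close> speaks of Borel predicates.\<close>
  from AE_E[OF b] obtain N where N: "{r. b0 r \<noteq> b r} \<subseteq> N" "N \<in> null_sets lborel"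
    by (auto simp: null_sets_def)
  then have [measurable]: "N \<in> sets borel" by auto
  have "AE z in lborel. modulus z \<notin> N"
    using AE_not_in[OF N(2)] by (subst AE_modulus_iff) (auto elim: eventually_mono)
  moreover have "AE z in lborel. ?pos (modulus z)"
    by (subst AE_modulus_iff) auto
  ultimately have "AE z in lborel. a z = b (modulus z)"
  proof eventually_elim
    case (elim z)
    then have "b0 (modulus z) = b (modulus z)" using N(1) by blast
    with elim show ?case by (simp add: b0_def a_mod)
  qed
  moreover have "AE r in lborel. ?pos r \<longrightarrow> a (\<chi> j. complex_of_real (r $ j)) = b r"
    using b by eventually_elim (auto simp: b0_def)
  ultimately show thesis by (intro that[of b]) auto
qed

section \<open>Dirichlet integrals\<close>

text \<open>Integration by parts: (k+1) F - x^(k+1) exp(-x) is the next antiderivative. Its value at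
  0 and its limit encode the Gamma integral k!. Keeping the antiderivative itself allows both
  substitutions below, t x and t r^2, to be made by the chain rule.\<close>

lemma power_exp_antiderivative:
  "\<exists>F :: real \<Rightarrow> real. (\<forall>x. (F has_real_derivative x ^ k * exp (- x)) (at x)) \<and> F 0
      = - fact k \<and> (F \<longlongrightarrow> 0) at_top"
proof (induction k)
  case 0
  have "((\<lambda>x :: real. - exp (- x)) \<longlongrightarrow> 0) at_top"
    using tendsto_minus[OF tendsto_power_div_exp_0[of 0]] by (simp add: exp_minus divide_inverse)
  then show ?case
    by (intro exI[of _ "\<lambda>x. - exp (- x)"]) (auto intro!: derivative_eq_intros)
next
  case (Suc k)
  then obtain F :: "real \<Rightarrow> real" where F: "\<And>x. (F has_real_derivative x ^ k * exp (- x)) (at x)"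
    "F 0 = - fact k" "(F \<longlongrightarrow> 0) at_top" by blast
  have "((\<lambda>x. (real k + 1) * F x - x ^ Suc k / exp x) \<longlongrightarrow> (real k + 1) * 0 - 0) at_top"
    by (intro tendsto_intros F tendsto_power_div_exp_0)
  moreover have "((\<lambda>x. (real k + 1) * F x - x ^ Suc k / exp x) has_real_derivative x ^ Suc k
      * exp (- x)) (at x)" for x
  proof -
    have "((\<lambda>x. (real k + 1) * F x - x ^ Suc k * exp (- x)) has_real_derivative x ^ Suc k
        * exp (- x)) (at x)"
    proof -
      have "((\<lambda>x :: real. x ^ Suc k) has_real_derivative (real k + 1) * x ^ k) (at x)"
        using DERIV_pow[of "Suc k" x] by (simp add: add_ac)
      moreover have "((\<lambda>x :: real. exp (- x)) has_real_derivative - exp (- x)) (at x)"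
        by (auto intro!: derivative_eq_intros)
      ultimately show ?thesis
        by (rule DERIV_diff[OF DERIV_cmult[OF F(1)] DERIV_mult, THEN DERIV_cong])
            (simp add: algebra_simps)
    qed
    then show ?thesis by (simp add: exp_minus divide_inverse)
  qed
  ultimately show ?case
    using F(2) by (intro exI[of _ "\<lambda>x. (real k + 1) * F x - x ^ Suc k / exp x"])
        (auto simp: algebra_simps)
qed

lemma nn_integral_power_exp:
  fixes t :: real
  assumes "t > 0"
  shows "(\<integral>\<^sup>+x. ennreal (x ^ k * exp (- t * x)) * indicator {0..} x \<partial>lborel)
      = ennreal (fact k / t ^ (k + 1))"
proof -
  obtain F :: "real \<Rightarrow> real" where F: "\<And>x. (F has_real_derivative x ^ k * exp (- x)) (at x)"
    "F 0 = - fact k" "(F \<longlongrightarrow> 0) at_top" using power_exp_antiderivative[of k] by blast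
  have "((\<lambda>x. F (t * x) / t ^ (k + 1)) \<longlongrightarrow> 0 / t ^ (k + 1)) at_top"
    using assms by (intro tendsto_intros filterlim_compose[OF F(3)]
        filterlim_tendsto_pos_mult_at_top[OF tendsto_const] filterlim_ident) auto
  moreover have "((\<lambda>x. F (t * x) / t ^ (k + 1)) has_real_derivative x ^ k * exp (- t * x)) (at x)"
      for x
    using assms by (auto intro!: derivative_eq_intros DERIV_chain2[OF F(1)]
        simp: power_mult_distrib)
  ultimately have "(\<integral>\<^sup>+x. ennreal (x ^ k * exp (- t * x)) * indicator {0..} x \<partial>lborel)
     = ennreal (0 / t ^ (k + 1) - F (t * 0) / t ^ (k + 1))"
    using assms by (intro nn_integral_FTC_atLeast) auto
  then show ?thesis by (simp add: F(2))
qed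

text \<open>The substitution u = t r^2 reduces this to the Gamma integral. It is the integral over
  the plane of |z|^(2k) exp(-t |z|^2) in polar coordinates.\<close>

lemma nn_integral_odd_power_gaussian:
  fixes t :: real
  assumes "t > 0"
  shows "(\<integral>\<^sup>+r. ennreal (2 * pi * max 0 r * (r ^ (2 * k) * exp (- t * r\<^sup>2))) \<partial>lborel)
      = ennreal (pi * fact k / t ^ (k + 1))"
proof -
  obtain F :: "real \<Rightarrow> real" where F: "\<And>x. (F has_real_derivative x ^ k * exp (- x)) (at x)"
    "F 0 = - fact k" "(F \<longlongrightarrow> 0) at_top" using power_exp_antiderivative[of k] by blast
  have "((\<lambda>r. pi * F (t * r\<^sup>2) / t ^ (k + 1)) \<longlongrightarrow> pi * 0 / t ^ (k + 1)) at_top"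
    using assms by (intro tendsto_intros filterlim_compose[OF F(3)]
        filterlim_tendsto_pos_mult_at_top[OF tendsto_const] filterlim_pow_at_top filterlim_ident)
            auto
  moreover have "((\<lambda>r. pi * F (t * r\<^sup>2) / t ^ (k + 1)) has_real_derivative 2 * pi * r
      * (r ^ (2 * k) * exp (- t * r\<^sup>2))) (at r)" for r
    using assms by (auto intro!: derivative_eq_intros DERIV_chain2[OF F(1)]
        simp: power_mult_distrib power_mult)
  ultimately have "(\<integral>\<^sup>+r. ennreal (2 * pi * r
      * (r ^ (2 * k) * exp (- t * r\<^sup>2))) * indicator {0..} r \<partial>lborel)
     = ennreal (pi * 0 / t ^ (k + 1) - pi * F (t * 0\<^sup>2) / t ^ (k + 1))"
    using assms by (intro nn_integral_FTC_atLeast) auto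
  also have "(\<integral>\<^sup>+r. ennreal (2 * pi * r
      * (r ^ (2 * k) * exp (- t * r\<^sup>2))) * indicator {0..} r \<partial>lborel)
    = (\<integral>\<^sup>+r. ennreal (2 * pi * max 0 r * (r ^ (2 * k) * exp (- t * r\<^sup>2))) \<partial>lborel)"
    by (intro nn_integral_cong) (auto simp: indicator_def max_def)
  finally show ?thesis by (simp add: F(2))
qed

text \<open>Writing \<open>N! / (1 + s)^(N + 1)\<close> as the integral of \<open>t^N exp (- t (1 + s))\<close> over \<open>t \<ge> 0\<close>
  separates the variables.\<close>

lemma nn_integral_dirichlet:
  fixes p :: "nat ^ 'n"
  assumes p: "mi_size p \<le> m"
  shows "(\<integral>\<^sup>+r. ennreal ((\<Prod>j\<in>UNIV. 2 * pi * max 0 (r $ j)) *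
            ((\<Prod>j\<in>UNIV. (r $ j) ^ (2 * p $ j)) / (1 + (\<Sum>j\<in>UNIV. (r $ j)\<^sup>2)) ^ (CARD('n) + m + 1)))
                \<partial>lborel)
       = ennreal (pi ^ CARD('n) * mi_fact p * fact (m - mi_size p) / fact (CARD('n) + m))"
proof -
  let ?N = "CARD('n) + m"
  define g where "g t j r = 2 * pi * max 0 r * (r ^ (2 * p $ j) * exp (- t * r\<^sup>2))"
      for t r :: real and j :: 'n
  \<comment> \<open>The joint integrand in \<open>t\<close> and \<open>r\<close>. Integrating out
    \<open>t\<close> returns (n+m)! times the Dirichlet integrand (\<open>inner_t\<close>);
    integrating out \<open>r\<close> leaves a single Gamma integral in \<open>t\<close>
    (\<open>inner_r\<close>).\<close>
  define W where "W t r = t ^ ?N * exp (- t) * (\<Prod>j\<in>UNIV. g t j (r $ j))" for t and r :: "real ^ 'n"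
  define A where "A r = (\<Prod>j\<in>UNIV. 2 * pi * max 0 (r $ j)) * (\<Prod>j\<in>UNIV. (r $ j) ^ (2 * p $ j))"
      for r :: "real ^ 'n"
  define s where "s r = 1 + (\<Sum>j\<in>UNIV. (r $ j)\<^sup>2)" for r :: "real ^ 'n"
  have s: "s r > 0" for r
    unfolding s_def by (intro add_pos_nonneg sum_nonneg) auto
  have g: "g t j r \<ge> 0" for t j r
    by (simp add: g_def power_mult)
  have A: "A r \<ge> 0" for r
    by (auto simp: A_def power_mult intro!: mult_nonneg_nonneg prod_nonneg)
  have W: "W t r = A r * (t ^ ?N * exp (- s r * t))" for t r
    by (simp add: W_def A_def s_def g_def prod.distrib exp_sum[symmetric] exp_add[symmetric]
        sum_distrib_left
          sum_negf algebra_simps)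
  have inner_t: "(\<integral>\<^sup>+t. ennreal (W t r) * indicator {0..} t \<partial>lborel)
      = ennreal (A r * (fact ?N / s r ^ (?N + 1)))" for r
  proof -
    have "(\<integral>\<^sup>+t. ennreal (W t r) * indicator {0..} t \<partial>lborel)
        = (\<integral>\<^sup>+t. ennreal (A r) * (ennreal (t ^ ?N * exp (- s r * t)) * indicator {0..} t) \<partial>lborel)"
      by (intro nn_integral_cong) (auto simp: W indicator_def A simp flip: ennreal_mult)
    also have "\<dots> = ennreal (A r) * ennreal (fact ?N / s r ^ (?N + 1))"
      by (subst nn_integral_cmult) (use nn_integral_power_exp[OF s[of r], of ?N] in auto)
    finally show ?thesis
      using s[of r] by (simp add: A flip: ennreal_mult)
  qed
  have inner_r: "(\<integral>\<^sup>+r. ennreal (W t r) \<partial>lborel)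
      = ennreal (pi ^ CARD('n) * mi_fact p) * ennreal (t ^ (m - mi_size p) * exp (- 1 * t))"
    if t: "t > 0" for t
  proof -
    have "(\<integral>\<^sup>+r. ennreal (W t r) \<partial>lborel)
        = (\<integral>\<^sup>+r. ennreal (t ^ ?N * exp (- t)) * (\<Prod>j\<in>UNIV. ennreal (g t j (r $ j))) \<partial>lborel)"
      using t g by (intro nn_integral_cong)
          (auto simp: W_def prod_ennreal prod_nonneg simp flip: ennreal_mult)
    also have "\<dots> = ennreal (t ^ ?N * exp (- t)) * (\<Prod>j\<in>UNIV. \<integral>\<^sup>+x. ennreal (g t j x) \<partial>lborel)"
      by (subst nn_integral_cmult,
          (simp add: g_def)) (subst nn_integral_lborel_vec_prod, auto simp: g_def)
    also have "\<dots> = ennreal (t ^ ?N * exp (- t))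
        * (\<Prod>j\<in>UNIV. ennreal (pi * fact (p $ j) / t ^ (p $ j + 1)))"
      unfolding g_def by (simp only: nn_integral_odd_power_gaussian[OF t])
    also have "\<dots> = ennreal (t ^ ?N * exp (- t) * (\<Prod>j\<in>UNIV. pi * fact (p $ j) / t ^ (p $ j + 1)))"
      using t by (simp add: prod_ennreal ennreal_mult prod_nonneg)
    also have "(\<Prod>j\<in>UNIV. pi * fact (p $ j) / t ^ (p $ j + 1))
        = pi ^ CARD('n) * mi_fact p / t ^ (CARD('n) + mi_size p)"
      by (simp add: prod_dividef prod.distrib mi_fact_def mi_size_def power_add power_sum)
    also have "t ^ ?N * exp (- t) * (pi ^ CARD('n) * mi_fact p / t ^ (CARD('n) + mi_size p))
        = pi ^ CARD('n) * mi_fact p * (t ^ (m - mi_size p) * exp (- 1 * t))"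
    proof -
      \<comment> \<open>The Gaussians leave t^(n+|p|) in the denominator, so the power m-|p| of
        \<open>t\<close> remains. It is nonnegative because of the assumption on
        \<open>p\<close>.\<close>
      have "t ^ ?N = t ^ (CARD('n) + mi_size p) * t ^ (m - mi_size p)"
        using p by (simp flip: power_add)
      then show ?thesis using t by simp
    qed
    finally show ?thesis
      using t by (simp add: ennreal_mult mi_fact_def prod_nonneg)
  qed
  have "ennreal (fact ?N) * (\<integral>\<^sup>+r. ennreal (A r / s r ^ (?N + 1)) \<partial>lborel)
      = (\<integral>\<^sup>+r. (\<integral>\<^sup>+t. ennreal (W t r) * indicator {0..} t \<partial>lborel) \<partial>lborel)"
    unfolding inner_t using s A
    by (subst nn_integral_cmult[symmetric])
       (auto simp: A_def s_def less_imp_le mult_ac simp flip: ennreal_mult intro!: nn_integral_cong)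
  also have "\<dots> = (\<integral>\<^sup>+t. (\<integral>\<^sup>+r. ennreal (W t r) * indicator {0..} t \<partial>lborel) \<partial>lborel)"
  proof (rule pair_sigma_finite.Fubini')
    show "(\<lambda>(t, r). ennreal (W t r) * indicator {0..} t) \<in> borel_measurable (lborel \<Otimes>\<^sub>M lborel)"
      unfolding W_def g_def by measurable
  qed unfold_locales
  also have "\<dots> = (\<integral>\<^sup>+t. ennreal (pi ^ CARD('n) * mi_fact p)
      * (ennreal (t ^ (m - mi_size p) * exp (- 1 * t)) * indicator {0..} t) \<partial>lborel)"
  proof (rule nn_integral_cong_AE)
    \<comment> \<open>\<open>inner_r\<close> holds only for positive \<open>t\<close>, whereas the
      indicator includes 0.\<close>
    have "AE t in lborel. t \<noteq> (0 :: real)"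
      by (rule AE_lborel_singleton)
    then show "AE t in lborel. (\<integral>\<^sup>+r. ennreal (W t r) * indicator {0..} t \<partial>lborel)
       = ennreal (pi ^ CARD('n) * mi_fact p)
           * (ennreal (t ^ (m - mi_size p) * exp (- 1 * t)) * indicator {0..} t)"
      by (rule eventually_mono) (auto simp: indicator_def inner_r)
  qed
  also have "\<dots> = ennreal (pi ^ CARD('n) * mi_fact p) * ennreal (fact (m - mi_size p))"
    by (subst nn_integral_cmult) (use nn_integral_power_exp[of 1 "m - mi_size p"] in auto)
  also have "\<dots> = ennreal (fact ?N) * ennreal (pi ^ CARD('n) * mi_fact p
      * fact (m - mi_size p) / fact ?N)"
    by (simp add: mi_fact_def prod_nonneg flip: ennreal_mult)
  finally have "(\<integral>\<^sup>+r. ennreal (A r / s r ^ (?N + 1)) \<partial>lborel)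
      = ennreal (pi ^ CARD('n) * mi_fact p * fact (m - mi_size p) / fact ?N)"
    by (subst (asm) ennreal_mult_cancel_left) auto
  then show ?thesis by (simp add: A_def s_def)
qed

section \<open>Monomials and radial symbols\<close>

definition radial_density :: "nat \<Rightarrow> real ^ 'n \<Rightarrow> real" where
  "radial_density m r = fact (CARD('n) + m) / (pi ^ CARD('n) * fact m) /
     (1 + (\<Sum>j\<in>UNIV. (r $ j)\<^sup>2)) ^ (CARD('n) + m + 1)"

lemma one_plus_sum_squares_pos: "0 < 1 + (\<Sum>j\<in>A. (f j :: real)\<^sup>2)"
  by (intro add_pos_nonneg sum_nonneg) auto

lemma radial_density_nonneg: "radial_density m r \<ge> 0"
  using one_plus_sum_squares_pos[of "($) r" UNIV] by (simp add: radial_density_def)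

lemma even_monomial_nonneg:
  fixes r :: "real ^ 'n"
  shows "0 \<le> (\<Prod>j\<in>UNIV. (r $ j) ^ (2 * p $ j))"
  by (intro prod_nonneg zero_le_even_power) auto

lemma borel_measurable_radial_density [measurable]: "radial_density m \<in> borel_measurable borel"
  unfolding radial_density_def by measurable

lemma nu_eq: "nu m = density lebesgue (\<lambda>z. ennreal (radial_density m (modulus z)))"
  by (simp add: nu_def radial_density_def)

lemma sets_nu [measurable_cong]: "sets (nu m) = sets lebesgue"
  by (simp add: nu_eq)

lemma borel_measurable_nu: "f \<in> borel_measurable borel \<Longrightarrow> f \<in> borel_measurable (nu m)"
  by (subst measurable_cong_sets[OF sets_nu refl]) (auto intro: measurable_completion)

lemma measurable_nu_iff: "f \<in> measurable (nu m) N \<longleftrightarrow> f \<in> measurable lebesgue N"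
  by (subst measurable_cong_sets[OF sets_nu refl]) auto

lemma nn_integral_nu:
  assumes [measurable]: "f \<in> borel_measurable borel"
  shows "(\<integral>\<^sup>+z. f z \<partial>nu m) = (\<integral>\<^sup>+z. ennreal (radial_density m (modulus z)) * f z \<partial>lborel)"
proof -
  have [measurable]: "f \<in> borel_measurable lebesgue"
    by (intro measurable_completion) simp
  have [measurable]: "(\<lambda>z. ennreal (radial_density m (modulus z))) \<in> borel_measurable lebesgue"
    by (intro measurable_completion) simp
  show ?thesis
    unfolding nu_eq by (subst nn_integral_density) (auto simp: nn_integral_completion)
qed

text \<open>Measurability of \<open>f\<close> follows from that of \<open>g\<close> by completeness.
  This makes it applicable to the integrand of \<open>gamma\<close>, which is controlled only almost
  everywhere.\<close>

lemma integral_lebesgue_AE_eq: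
  fixes f g :: "'a::euclidean_space \<Rightarrow> 'b::euclidean_space"
  assumes g: "g \<in> borel_measurable borel" and ae: "AE x in lborel. f x = g x"
  shows "(\<integral>x. f x \<partial>lebesgue) = (\<integral>x. g x \<partial>lborel)"
proof -
  have ae': "AE x in lebesgue. f x = g x"
    using ae by (rule AE_completion)
  have g': "g \<in> borel_measurable lebesgue"
    using g by (intro measurable_completion) simp
  have "f \<in> borel_measurable lebesgue"
    using ae' by (intro borel_measurable_AE[OF g']) (auto elim: eventually_mono)
  then have "(\<integral>x. f x \<partial>lebesgue) = (\<integral>x. g x \<partial>lebesgue)"
    using g' ae' by (intro integral_cong_AE)
  then show ?thesis
    using g by (simp add: integral_completion)
qed

lemma integral_nu_AE_eq:
  fixes f g :: "complex ^ 'n \<Rightarrow> complex"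
  assumes g: "g \<in> borel_measurable borel" and f: "f \<in> borel_measurable lebesgue"
    and ae: "AE z in lborel. f z = g z"
  shows "(\<integral>z. f z \<partial>nu m) = (\<integral>z. complex_of_real (radial_density m (modulus z)) * g z \<partial>lborel)"
proof -
  have [measurable]: "(\<lambda>z. radial_density m (modulus z)) \<in> borel_measurable lebesgue"
    by (intro measurable_completion) simp
  have "(\<integral>z. f z \<partial>nu m) = (\<integral>z. radial_density m (modulus z) *\<^sub>R f z \<partial>lebesgue)"
    unfolding nu_eq using f by (intro integral_density) (auto simp: radial_density_nonneg)
  also have "\<dots> = (\<integral>z. complex_of_real (radial_density m (modulus z)) * g z \<partial>lborel)"
    using g ae by (intro integral_lebesgue_AE_eq)
        (auto simp: scaleR_conv_of_real elim: eventually_mono)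
  finally show ?thesis .
qed

lemma borel_measurable_mi_power [measurable]: "(\<lambda>z. mi_power z p) \<in> borel_measurable borel"
  unfolding mi_power_def by measurable

lemma borel_measurable_cnj [measurable]: "cnj \<in> borel_measurable borel"
  by (intro borel_measurable_continuous_onI continuous_intros)

lemma borel_measurable_symbol_mi_power:
  assumes "a \<in> borel_measurable lebesgue"
  shows "(\<lambda>z. a z * (mi_power z p * cnj (mi_power z q))) \<in> borel_measurable lebesgue"
proof -
  have "(\<lambda>z. mi_power z p * cnj (mi_power z q)) \<in> borel_measurable lebesgue"
    by (intro measurable_completion) (simp, measurable)
  with assms show ?thesis
    by (rule borel_measurable_times)
qed

lemma cmod_mi_power: "(cmod (mi_power z p))\<^sup>2 = (\<Prod>j\<in>UNIV. (modulus z $ j) ^ (2 * p $ j))"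
  by (simp add: mi_power_def prod_power_distrib norm_power mult.commute flip: prod_norm power_mult)

lemma mi_power_cnj: "mi_power (\<chi> j. cnj (z $ j)) p = cnj (mi_power z p)"
  by (simp add: mi_power_def)

text \<open>After passing to moduli this is the Dirichlet integral, with pi^n and (n+m)! cancelling
  against the constant of \<open>nu\<close>. Its finiteness is the source of all integrability
  statements below.\<close>

lemma nn_integral_mi_power:
  fixes p :: "nat ^ 'n"
  assumes "p \<in> J m"
  shows "(\<integral>\<^sup>+z. ennreal ((cmod (mi_power z p))\<^sup>2) \<partial>nu m)
      = ennreal (mi_fact p * fact (m - mi_size p) / fact m)"
proof -
  let ?c = "fact (CARD('n) + m) / (pi ^ CARD('n) * fact m) :: real"
  let ?S = "\<lambda>r :: real ^ 'n. (\<Prod>j\<in>UNIV. (r $ j) ^ (2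
      * p $ j)) / (1 + (\<Sum>j\<in>UNIV. (r $ j)\<^sup>2)) ^ (CARD('n) + m + 1)"
  let ?M = "\<lambda>r :: real ^ 'n. \<Prod>j\<in>UNIV. 2 * pi * max 0 (r $ j)"
  have S: "?S r \<ge> 0" for r
    using one_plus_sum_squares_pos[of "($) r" UNIV] even_monomial_nonneg[of r p] by simp
  have "(\<integral>\<^sup>+z. ennreal ((cmod (mi_power z p))\<^sup>2) \<partial>nu m)
     = (\<integral>\<^sup>+z. ennreal ?c * ennreal (?S (modulus z)) \<partial>lborel)"
  proof (subst nn_integral_nu)
    have "ennreal (radial_density m r) * ennreal (\<Prod>j\<in>UNIV. (r $ j) ^ (2 * p $ j))
        = ennreal ?c * ennreal (?S r)" for r :: "real ^ 'n"
      using radial_density_nonneg[of m r] by (simp add: radial_density_def flip: ennreal_mult')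
    then show "(\<integral>\<^sup>+z. ennreal (radial_density m (modulus z))
        * ennreal ((cmod (mi_power z p))\<^sup>2) \<partial>lborel)
       = (\<integral>\<^sup>+z. ennreal ?c * ennreal (?S (modulus z)) \<partial>lborel)"
      by (simp only: cmod_mi_power)
  qed measurable
  also have "\<dots> = ennreal ?c * (\<integral>\<^sup>+r. ennreal (?S r) \<partial>distr lborel borel modulus)"
    by (subst nn_integral_cmult) (auto simp: nn_integral_distr)
  also have "(\<integral>\<^sup>+r. ennreal (?S r) \<partial>distr lborel borel modulus)
      = (\<integral>\<^sup>+r. ennreal (?M r * ?S r) \<partial>lborel)"
    unfolding distr_modulus
  proof (subst nn_integral_density)
    have "ennreal (?M r * ?S r) = ennreal (?M r) * ennreal (?S r)" for r
      by (rule ennreal_mult') (auto intro!: prod_nonneg)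
    then show "(\<integral>\<^sup>+r. ennreal (?M r) * ennreal (?S r) \<partial>lborel)
        = (\<integral>\<^sup>+r. ennreal (?M r * ?S r) \<partial>lborel)"
      by (simp only:)
  qed measurable
  also have "\<dots> = ennreal (pi ^ CARD('n) * mi_fact p * fact (m - mi_size p) / fact (CARD('n) + m))"
    using assms by (intro nn_integral_dirichlet) (simp add: J_def)
  also have "ennreal ?c * \<dots> = ennreal (mi_fact p * fact (m - mi_size p) / fact m)"
    by (subst ennreal_mult'[symmetric]) (auto simp: mi_fact_def prod_nonneg)
  finally show ?thesis .
qed

lemma integrable_mi_power:
  assumes "p \<in> J m"
  shows "integrable (nu m) (\<lambda>z. (cmod (mi_power z p))\<^sup>2)"
  unfolding integrable_iff_bounded
  using nn_integral_mi_power[OF assms] by (auto intro!: borel_measurable_nu)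

lemma integral_mi_power:
  assumes "p \<in> J m"
  shows "(\<integral>z. (cmod (mi_power z p))\<^sup>2 \<partial>nu m) = mi_fact p * fact (m - mi_size p) / fact m"
  by (subst integral_eq_nn_integral)
      (auto simp: nn_integral_mi_power[OF assms] mi_fact_def prod_nonneg intro!:
          borel_measurable_nu)

lemma integrable_symbol_mi_power:
  assumes a: "a \<in> borel_measurable lebesgue" "bounded (range a)" and p: "p \<in> J m" and q: "q \<in> J m"
  shows "integrable (nu m) (\<lambda>z. a z * (mi_power z p * cnj (mi_power z q)))"
proof -
  obtain K where K: "\<And>z. cmod (a z) \<le> K"
    using a(2) by (auto simp: bounded_iff)
  have "integrable (nu m) (\<lambda>z. K * ((cmod (mi_power z p))\<^sup>2 + (cmod (mi_power z q))\<^sup>2))"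
    using p q by (intro integrable_mult_right Bochner_Integration.integrable_add
        integrable_mi_power)
  then show ?thesis
  proof (rule Bochner_Integration.integrable_bound)
    show "(\<lambda>z. a z * (mi_power z p * cnj (mi_power z q))) \<in> borel_measurable (nu m)"
      using a(1) by (simp add: measurable_nu_iff borel_measurable_symbol_mi_power)
    have "cmod (a z * (mi_power z p * cnj (mi_power z q)))
        \<le> K * ((cmod (mi_power z p))\<^sup>2 + (cmod (mi_power z q))\<^sup>2)" for z
    proof -
      have "2 * (cmod (mi_power z p) * cmod (mi_power z q))
          \<le> (cmod (mi_power z p))\<^sup>2 + (cmod (mi_power z q))\<^sup>2"
        using sum_squares_bound[of "cmod (mi_power z p)" "cmod (mi_power z q)"] by simp
      moreover have "0 \<le> cmod (mi_power z p) * cmod (mi_power z q)" by simp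
      ultimately have "cmod (mi_power z p) * cmod (mi_power z q)
          \<le> (cmod (mi_power z p))\<^sup>2 + (cmod (mi_power z q))\<^sup>2"
        by linarith
      then show ?thesis
        using K[of z] by (auto simp: norm_mult intro!: mult_mono intro: order_trans[OF
            norm_ge_zero])
    qed
    then show "AE z in nu m. cmod (a z * (mi_power z p * cnj (mi_power z q)))
        \<le> norm (K * ((cmod (mi_power z p))\<^sup>2 + (cmod (mi_power z q))\<^sup>2))"
      by (intro AE_I2) (auto intro: order_trans[OF _ abs_ge_self])
  qed
qed

lemma integral_mi_power_orthogonal:
  fixes a :: "complex ^ 'n \<Rightarrow> complex"
  assumes a: "a \<in> borel_measurable lebesgue" "separately_radial a" and pq: "p \<noteq> q"
  shows "(\<integral>z. a z * (mi_power z p * cnj (mi_power z q)) \<partial>nu m) = 0"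
proof -
  obtain b where [measurable]: "b \<in> borel_measurable borel" and b: "AE z in lborel. a z
      = b (modulus z)"
    using separately_radial_representation[OF a] by metis
  obtain k where k: "p $ k \<noteq> q $ k"
    using pq by (auto simp: vec_eq_iff)
  \<comment> \<open>With this angle, turning coordinate \<open>k\<close> multiplies the product of
    z^p and the conjugate of z^q by exp(i pi) = -1, so its integral equals its own negative. The
    subtraction is real, since the natural one would truncate.\<close>
  define \<theta> where "\<theta> = pi / (real (p $ k) - real (q $ k))"
  define T where "T z = (\<chi> j. if j = k then cis \<theta> * z $ j else z $ j)" for z :: "complex ^ 'n"
  have [measurable]: "T \<in> borel_measurable borel"
    unfolding T_def by (intro borel_measurable_vec_lambda) auto
  have T: "distr lborel borel T = lborel"
    unfolding T_def by (rule lborel_distr_rotation_coord) simp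
  have mod_T: "modulus (T z) = modulus z" for z
    by (auto simp: T_def vec_eq_iff norm_mult)
  have power_T: "mi_power (T z) p' = cis \<theta> ^ (p' $ k) * mi_power z p'" for z p'
  proof -
    have "mi_power (T z) p' = (\<Prod>j\<in>UNIV. (if j
        = k then cis \<theta> ^ (p' $ k) else 1) * (z $ j) ^ (p' $ j))"
      unfolding mi_power_def by (intro prod.cong) (auto simp: T_def power_mult_distrib)
    then show ?thesis
      by (simp add: prod.distrib mi_power_def)
  qed
  have "cis \<theta> ^ (p $ k) * cnj (cis \<theta> ^ (q $ k)) = cis ((real (p $ k) - real (q $ k)) * \<theta>)"
    by (simp only: complex_cnj_power cis_cnj Complex.DeMoivre cis_mult) (simp add: algebra_simps)
  also have "\<dots> = -1"
    using k by (simp add: \<theta>_def)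
  finally have c: "cis \<theta> ^ (p $ k) * cnj (cis \<theta> ^ (q $ k)) = -1" .
  \<comment> \<open>\<open>b\<close> takes the place of \<open>a\<close> to make \<open>f\<close>
    Borel, as the change of variables along \<open>T\<close> demands.\<close>
  define f where "f z = complex_of_real (radial_density m (modulus z)) * (b (modulus z)
      * (mi_power z p * cnj (mi_power z q)))" for z
  have [measurable]: "f \<in> borel_measurable borel"
    unfolding f_def by measurable
  have f_T: "f (T z) = - f z" for z
  proof -
    have "f (T z) = cis \<theta> ^ (p $ k) * cnj (cis \<theta> ^ (q $ k)) * f z"
      by (simp add: f_def mod_T power_T)
    then show ?thesis by (simp only: c) simp
  qed
  have "(\<integral>z. a z * (mi_power z p * cnj (mi_power z q)) \<partial>nu m) = (\<integral>z. f z \<partial>lborel)"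
    unfolding f_def
  proof (intro integral_nu_AE_eq borel_measurable_symbol_mi_power a(1))
    show "AE z in lborel. a z * (mi_power z p * cnj (mi_power z q))
        = b (modulus z) * (mi_power z p * cnj (mi_power z q))"
      using b by eventually_elim simp
  qed measurable
  also have "(\<integral>z. f z \<partial>lborel) = 0"
  proof -
    have "(\<integral>z. f z \<partial>lborel) = (\<integral>z. f z \<partial>distr lborel borel T)"
      by (simp add: T)
    also have "\<dots> = - (\<integral>z. f z \<partial>lborel)"
      by (subst integral_distr) (auto simp: f_T)
    finally show ?thesis by simp
  qed
  finally show ?thesis .
qed

text \<open>The factor r_j of the polar density raises the exponent 2 p_j coming from the squared
  modulus to the exponent 2 p_j + 1 in \<open>gamma\<close>.\<close>

lemma integral_mi_power_gamma:
  fixes a :: "complex ^ 'n \<Rightarrow> complex"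
  assumes a: "a \<in> borel_measurable lebesgue" "separately_radial a"
  shows "(\<integral>z. a z * (mi_power z p * cnj (mi_power z p)) \<partial>nu m)
       = complex_of_real (mi_fact p * fact (m - mi_size p) / fact m) * gamma a m p"
proof -
  obtain b where [measurable]: "b \<in> borel_measurable borel"
    and b_pos: "AE r in lborel. (\<forall>j. 0 < r $ j) \<longrightarrow> a (\<chi> j. complex_of_real (r $ j)) = b r"
    and b: "AE z in lborel. a z = b (modulus z)"
    by (rule separately_radial_representation[OF a])
  define D where "D r = (1 + (\<Sum>j\<in>UNIV. (r $ j)\<^sup>2)) ^ (CARD('n) + m + 1)" for r :: "real ^ 'n"
  define Q where "Q r = (\<Prod>j\<in>UNIV. (r $ j) ^ (2 * p $ j))" for r :: "real ^ 'n"
  have [measurable]: "D \<in> borel_measurable borel" "Q \<in> borel_measurable borel"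
    unfolding D_def Q_def by measurable
  let ?c = "fact (CARD('n) + m) / (pi ^ CARD('n) * fact m) :: real"
  let ?I = "\<integral>r. complex_of_real (\<Prod>j\<in>UNIV. max 0 (r $ j))
      * (b r * complex_of_real (Q r / D r)) \<partial>lborel"
  have "(\<integral>z. a z * (mi_power z p * cnj (mi_power z p)) \<partial>nu m)
      = (\<integral>z. complex_of_real (radial_density m (modulus z))
          * (b (modulus z) * complex_of_real (Q (modulus z))) \<partial>lborel)"
  proof (intro integral_nu_AE_eq borel_measurable_symbol_mi_power a(1))
    have "mi_power z p * cnj (mi_power z p) = complex_of_real (Q (modulus z))" for z
      by (simp only: Q_def cmod_mi_power[symmetric] complex_norm_square)
    then show "AE z in lborel. a z * (mi_power z p * cnj (mi_power z p))
        = b (modulus z) * complex_of_real (Q (modulus z))"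
      using b by (auto elim!: eventually_mono)
  qed measurable
  also have "\<dots> = (\<integral>r. complex_of_real (radial_density m r)
      * (b r * complex_of_real (Q r)) \<partial>distr lborel borel modulus)"
    by (subst integral_distr) auto
  also have "\<dots> = (\<integral>r. (\<Prod>j\<in>UNIV. 2 * pi * max 0 (r $ j)) *\<^sub>R (complex_of_real (radial_density m r)
      * (b r * complex_of_real (Q r))) \<partial>lborel)"
    unfolding distr_modulus by (subst integral_density) (auto intro!: prod_nonneg)
  also have "\<dots> = (\<integral>r. complex_of_real ((2 * pi) ^ CARD('n) * ?c)
      * (complex_of_real (\<Prod>j\<in>UNIV. max 0 (r $ j)) * (b r * complex_of_real (Q r / D r))) \<partial>lborel)"
  proof (intro Bochner_Integration.integral_cong refl)
    fix r :: "real ^ 'n"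
    have "(\<Prod>j\<in>UNIV. 2 * pi * max 0 (r $ j)) * (radial_density m r * Q r)
        = ((2 * pi) ^ CARD('n) * ?c) * ((\<Prod>j\<in>UNIV. max 0 (r $ j)) * (Q r / D r))"
      by (simp only: radial_density_def D_def prod.distrib prod_constant times_divide_eq_left
          times_divide_eq_right mult.assoc mult.left_commute power_mult_distrib)
    then have "complex_of_real (\<Prod>j\<in>UNIV. 2 * pi * max 0 (r $ j))
        * (complex_of_real (radial_density m r) * complex_of_real (Q r))
        = complex_of_real ((2 * pi) ^ CARD('n) * ?c)
            * (complex_of_real (\<Prod>j\<in>UNIV. max 0 (r $ j)) * complex_of_real (Q r / D r))"
      by (simp only: of_real_mult[symmetric])
    then show "(\<Prod>j\<in>UNIV. 2 * pi * max 0 (r $ j)) *\<^sub>R (complex_of_real (radial_density m r)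
        * (b r * complex_of_real (Q r)))
        = complex_of_real ((2 * pi) ^ CARD('n) * ?c) * (complex_of_real (\<Prod>j\<in>UNIV. max 0 (r $ j))
            * (b r * complex_of_real (Q r / D r)))"
      by (simp only: scaleR_conv_of_real mult.left_commute[of _ "b r"])
  qed
  also have "\<dots> = complex_of_real ((2 * pi) ^ CARD('n) * ?c) * ?I"
    by (rule integral_mult_right_zero)
  \<comment> \<open>The pi^n from the angles cancels the one normalizing \<open>nu\<close>.\<close>
  also have "(2 * pi) ^ CARD('n) * ?c = 2 ^ CARD('n) * fact (CARD('n) + m) / fact m"
    by (simp add: power_mult_distrib)
  also have "?I = (LINT r : {r :: real ^ 'n. \<forall>j. 0 \<le> r $ j} | lebesgue.
        a (\<chi> j. complex_of_real (r $ j)) *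
        complex_of_real ((\<Prod>j\<in>UNIV. (r $ j) ^ (2 * (p $ j) + 1)) /
          (1 + (\<Sum>j\<in>UNIV. (r $ j)\<^sup>2)) ^ (CARD('n) + m + 1)))"
    (is "_ = ?L")
    unfolding set_lebesgue_integral_def
  proof (rule integral_lebesgue_AE_eq[symmetric])
    show "AE r in lborel. indicat_real {r :: real ^ 'n. \<forall>j. 0 \<le> r $ j} r *\<^sub>R
            (a (\<chi> j. complex_of_real (r $ j)) *
             complex_of_real ((\<Prod>j\<in>UNIV. (r $ j) ^ (2 * (p $ j) + 1)) /
              (1 + (\<Sum>j\<in>UNIV. (r $ j)\<^sup>2)) ^ (CARD('n) + m + 1)))
          = complex_of_real (\<Prod>j\<in>UNIV. max 0 (r $ j)) * (b r * complex_of_real (Q r / D r))"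
      using b_pos
    proof eventually_elim
      case (elim r)
      show ?case
      proof (cases "\<forall>j. 0 < r $ j")
        case True
        then have "\<forall>j. 0 \<le> r $ j" by (simp add: less_imp_le)
        with True elim show ?thesis
          by (simp add: max_def D_def Q_def prod.distrib power_add)
      next
        \<comment> \<open>Off the open orthant nothing relates \<open>a\<close> to \<open>b\<close>,
          but both sides vanish. The right one contains \<open>max 0 (r $ k)\<close>, which is 0.
          The left one is killed by the indicator or, if all coordinates are nonnegative, by a power
          of \<open>r $ k = 0\<close> whose exponent is at least 1 even when \<open>p $ k\<close> is
          0.\<close>
        case False
        then obtain k where k: "r $ k \<le> 0" by (auto simp: not_less)
        then have 0: "(\<Prod>j\<in>UNIV. max 0 (r $ j)) = 0"
          using k by (intro prod_zero bexI[of _ k]) auto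
        show ?thesis
        proof (cases "\<forall>j. 0 \<le> r $ j")
          case True
          with k have "r $ k = 0" by (simp add: order_antisym)
          then have "(\<Prod>j\<in>UNIV. (r $ j) ^ (2 * (p $ j) + 1)) = 0"
            by (intro prod_zero bexI[of _ k]) auto
          with 0 show ?thesis
            by (simp only: of_real_0 div_0 mult_zero_left mult_zero_right scaleR_zero_right)
        qed (simp add: 0 del: of_real_prod)
      qed
    qed
  qed measurable
  finally have eq: "(\<integral>z. a z * (mi_power z p * cnj (mi_power z p)) \<partial>nu m)
      = complex_of_real (2 ^ CARD('n) * fact (CARD('n) + m) / fact m) * ?L" .
  have "mi_fact p \<noteq> 0"
    by (simp add: mi_fact_def)
  then have "2 ^ CARD('n) * fact (CARD('n) + m) / fact m
      = mi_fact p * fact (m - mi_size p) / fact m *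
        (2 ^ CARD('n) * fact (CARD('n) + m) / (mi_fact p * fact (m - mi_size p)))"
    by simp
  then have "complex_of_real (2 ^ CARD('n) * fact (CARD('n) + m) / fact m)
      = complex_of_real (mi_fact p * fact (m - mi_size p) / fact m) *
        complex_of_real (2 ^ CARD('n) * fact (CARD('n) + m) / (mi_fact p * fact (m - mi_size p)))"
    by (simp only: of_real_mult[symmetric])
  then show ?thesis
    unfolding eq gamma_def by (simp only: mult.assoc)
qed

section \<open>Toeplitz operators\<close>

lemma finite_J [simp]: "finite (J m :: (nat ^ 'n) set)"
proof (rule finite_subset)
  show "J m \<subseteq> vec_lambda ` (\<Pi>\<^sub>E j\<in>(UNIV :: 'n set). {..m})"
  proof
    fix p :: "nat ^ 'n" assume "p \<in> J m"
    then have "p $ j \<le> m" for j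
      using member_le_sum[of j UNIV "($) p"] by (auto simp: J_def mi_size_def intro: order_trans)
    then show "p \<in> vec_lambda ` (\<Pi>\<^sub>E j\<in>UNIV. {..m})"
      by (intro image_eqI[of _ _ "($) p"]) auto
  qed
qed (intro finite_imageI finite_PiE; simp)

text \<open>For \<open>p\<close> in \<open>J m\<close>, the reciprocal of the norm of the monomial
  z^p in \<open>L2 (nu m)\<close>.\<close>

definition weight :: "nat \<Rightarrow> nat ^ 'n \<Rightarrow> real" where
  "weight m p = sqrt (fact m / (mi_fact p * fact (m - mi_size p)))"

lemma mi_fact_pos: "mi_fact p > 0"
  by (simp add: mi_fact_def prod_pos)

lemma weight_pos: "weight m p > 0"
  by (simp add: weight_def mi_fact_pos)

lemma weight_nonzero [simp]: "weight m p \<noteq> 0"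
  using weight_pos[of m p] by simp

lemma weight_square: "complex_of_real (mi_fact p * fact (m - mi_size p) / fact m)
    = 1 / (complex_of_real (weight m p))\<^sup>2"
  by (simp add: weight_def mi_fact_pos less_imp_le flip: of_real_power)

lemma R_star_eq: "R_star m c = (\<lambda>z. \<Sum>p\<in>J m. complex_of_real (weight m p) * c p * mi_power z p)"
  by (simp add: R_star_def weight_def)

lemma l2_J: "l2 (J m) = {c :: nat ^ 'n \<Rightarrow> complex. \<forall>p. p \<notin> J m \<longrightarrow> c p = 0}"
  by (auto simp: l2_def)

lemma l2_inner_J: "l2_inner (J m) c d = (\<Sum>p\<in>J m. c p * cnj (d p))" for c :: "nat ^ 'n \<Rightarrow> complex"
  by (simp add: l2_inner_def)

lemma mult_op_l2_J: "c \<in> l2 (J m) \<Longrightarrow> mult_op g c \<in> l2 (J m)" for c :: "nat ^ 'n \<Rightarrow> complex"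
  by (simp add: l2_J mult_op_def)

text \<open>Rescaling coefficients by \<open>weight\<close> is invertible. Statements about
  polynomials can thereby be checked on coefficient families.\<close>

lemma bergman_space_eq: "bergman_space m = (R_star m :: (nat ^ 'n \<Rightarrow> complex) \<Rightarrow> _) ` l2 (J m)"
proof (intro equalityI subsetI)
  fix \<psi> :: "complex ^ 'n \<Rightarrow> complex" assume "\<psi> \<in> bergman_space m"
  then obtain c where c: "\<psi> = (\<lambda>z. \<Sum>p\<in>J m. c p * mi_power z p)"
    by (auto simp: bergman_space_def)
  let ?d = "\<lambda>p. if p \<in> J m then c p / complex_of_real (weight m p) else 0"
  have "\<psi> = R_star m ?d"
    by (auto simp: c R_star_eq intro!: sum.cong)
  moreover have "?d \<in> l2 (J m)"
    by (simp add: l2_J)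
  ultimately show "\<psi> \<in> R_star m ` l2 (J m)" by blast
qed (auto simp: bergman_space_def R_star_eq)

section \<open>The sesquilinear form of a symbol in normalized monomials\<close>

lemma symbol_R_star_expand:
  "a z * (R_star m c z * cnj (R_star m d z)) =
   (\<Sum>p\<in>J m. \<Sum>q\<in>J m. complex_of_real (weight m p * weight m q) * c p * cnj (d q) *
      (a z * (mi_power z p * cnj (mi_power z q))))"
  unfolding R_star_eq cnj_sum sum_product by (simp add: sum_distrib_left mult_ac)

lemma integrable_symbol_R_star:
  assumes "a \<in> borel_measurable lebesgue" "bounded (range a)"
  shows "integrable (nu m) (\<lambda>z. a z * (R_star m c z * cnj (R_star m d z)))"
  unfolding symbol_R_star_expand
  by (intro Bochner_Integration.integrable_sum integrable_mult_right integrable_symbol_mi_power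
      assms)

text \<open>Only the diagonal terms of the double sum survive, and there the two weights cancel the
  squared norm of the monomial.\<close>

lemma integral_symbol_R_star:
  fixes a :: "complex ^ 'n \<Rightarrow> complex"
  assumes a: "a \<in> borel_measurable lebesgue" "bounded (range a)" "separately_radial a"
  shows "(\<integral>z. a z * (R_star m c z * cnj (R_star m d z)) \<partial>nu m)
      = (\<Sum>p\<in>J m. gamma a m p * c p * cnj (d p))"
proof -
  have *: "(\<integral>z. a z * (mi_power z p * cnj (mi_power z q)) \<partial>nu m)
      = (if p = q then 1 / (complex_of_real (weight m p))\<^sup>2 * gamma a m p else 0)" for p q
  proof (cases "p = q")
    case True
    show ?thesis
      unfolding True integral_mi_power_gamma[OF a(1,3)] weight_square by simp
  qed (simp add: integral_mi_power_orthogonal[OF a(1,3)])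
  have "(\<integral>z. a z * (R_star m c z * cnj (R_star m d z)) \<partial>nu m)
      = (\<Sum>p\<in>J m. \<Sum>q\<in>J m. complex_of_real (weight m p * weight m q) * c p * cnj (d q) *
          (\<integral>z. a z * (mi_power z p * cnj (mi_power z q)) \<partial>nu m))"
    unfolding symbol_R_star_expand
    by (simp add: Bochner_Integration.integral_sum Bochner_Integration.integrable_sum
        integrable_symbol_mi_power a)
  also have "\<dots> = (\<Sum>p\<in>J m. gamma a m p * c p * cnj (d p))"
    unfolding *
    by (intro sum.cong refl)
       (simp add: if_distrib[of "\<lambda>x. _ * x"] sum.delta' power2_eq_square cong: if_cong)
  finally show ?thesis .
qed

text \<open>The squared norm of z^p is computed twice, by the Dirichlet integral and through
  \<open>gamma\<close>; comparison leaves 1.\<close>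

lemma gamma_one: "p \<in> J m \<Longrightarrow> gamma (\<lambda>_. 1) m p = 1"
proof -
  assume p: "p \<in> J m"
  have "(\<integral>z. 1 * (mi_power z p * cnj (mi_power z p)) \<partial>nu m)
      = (\<integral>z. complex_of_real ((cmod (mi_power z p))\<^sup>2) \<partial>nu m)"
    by (simp only: complex_norm_square mult_1)
  also have "\<dots> = complex_of_real (mi_fact p * fact (m - mi_size p) / fact m)"
    by (simp only: integral_complex_of_real integral_mi_power[OF p])
  finally show ?thesis
    using integral_mi_power_gamma[where a = "\<lambda>_. 1" and p = p and m = m] mi_fact_pos[of p]
    by (simp add: separately_radial_def)
qed

text \<open>The constant symbol 1 is bounded and separately radial, so orthonormality of the
  normalized monomials is a case of the diagonalization.\<close>

lemma
  shows integrable_R_star: "integrable (nu m) (\<lambda>z. R_star m c z * cnj (R_star m d z))"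
    and L2_inner_R_star: "L2_inner (nu m) (R_star m c) (R_star m d) = l2_inner (J m) c d"
proof -
  have one: "(\<lambda>_. 1) \<in> borel_measurable lebesgue" "bounded (range (\<lambda>_. 1))" "separately_radial
      (\<lambda>_. 1)"
    by (auto simp: separately_radial_def)
  show "integrable (nu m) (\<lambda>z. R_star m c z * cnj (R_star m d z))"
    using integrable_symbol_R_star[OF one(1,2)] by simp
  show "L2_inner (nu m) (R_star m c) (R_star m d) = l2_inner (J m) c d"
    using integral_symbol_R_star[OF one, of m c d] by (simp add: L2_inner_def l2_inner_J gamma_one)
qed

text \<open>Exhibits \<open>R\<close> as the map to coordinates along the normalized monomials, so
  that \<open>R_R_star\<close> reduces to \<open>L2_inner_R_star\<close>.\<close>

lemma R_eq_L2_inner: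
  "R m \<psi> p = (if p \<in> J m then L2_inner (nu m) \<psi> (R_star m (\<lambda>q. if q = p then 1 else 0)) else 0)"
proof (cases "p \<in> J m")
  case True
  then have unit: "R_star m (\<lambda>q. if q = p then 1 else 0)
      = (\<lambda>z. complex_of_real (weight m p) * mi_power z p)"
    by (simp add: R_star_eq if_distrib[of "\<lambda>x. _ * x"] if_distrib[of "\<lambda>x. x * _"] cong: if_cong)
  have "R m \<psi> p = complex_of_real (weight m p) * (\<integral>z. \<psi> z * cnj (mi_power z p) \<partial>nu m)"
    using True by (simp add: R_def weight_def mi_power_cnj)
  also have "\<dots> = (\<integral>z. complex_of_real (weight m p) * (\<psi> z * cnj (mi_power z p)) \<partial>nu m)"
    by (rule integral_mult_right_zero[symmetric])
  also have "\<dots> = L2_inner (nu m) \<psi> (R_star m (\<lambda>q. if q = p then 1 else 0))"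
    unfolding L2_inner_def unit
    by (intro Bochner_Integration.integral_cong refl) (simp add: mult.left_commute)
  finally show ?thesis
    using True by simp
qed (simp add: R_def)

lemma R_R_star: "c \<in> l2 (J m) \<Longrightarrow> R m (R_star m c) = c"
  by (auto simp: fun_eq_iff R_eq_L2_inner L2_inner_R_star l2_inner_J l2_J if_distrib[of "\<lambda>x. _
      * x"] if_distrib[of cnj] cong: if_cong)

lemma R_star_R: "\<psi> \<in> bergman_space m \<Longrightarrow> R_star m (R m \<psi>) = \<psi>"
  by (auto simp: bergman_space_eq R_R_star)

lemma R_star_add: "R_star m (\<lambda>p. c p + d p) = (\<lambda>z. R_star m c z + R_star m d z)"
  by (simp add: R_star_eq algebra_simps sum.distrib)

lemma R_star_cmult: "R_star m (\<lambda>p. k * c p) = (\<lambda>z. k * R_star m c z)"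
  by (simp add: R_star_eq sum_distrib_left mult_ac)

lemma isometric_isomorphism_R_star:
  "isometric_isomorphism (l2 (J m)) (l2_inner (J m)) (bergman_space m) (L2_inner (nu m)) (R_star m)"
  unfolding isometric_isomorphism_def
proof (intro conjI allI ballI)
  show "bij_betw (R_star m) (l2 (J m)) (bergman_space m)"
    unfolding bergman_space_eq by (intro inj_on_imp_bij_betw inj_on_inverseI[of _ "R m"] R_R_star)
qed (rule R_star_add R_star_cmult L2_inner_R_star)+

text \<open>Linearity and isometry are inherited from \<open>R_star\<close> through the inverse
  relation, rather than read off the integrals defining \<open>R\<close>.\<close>

lemma isometric_isomorphism_R:
  "isometric_isomorphism (bergman_space m) (L2_inner (nu m)) (l2 (J m)) (l2_inner (J m)) (R m)"
proof -
  have bij: "bij_betw (R m) (bergman_space m) (l2 (J m))"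
    by (rule bij_betw_byWitness[where f' = "R_star m"]) (auto simp: R_R_star bergman_space_eq)
  have add: "R m (\<lambda>x. f x + g x) = (\<lambda>y. R m f y + R m g y)"
    if f: "f \<in> bergman_space m" and g: "g \<in> bergman_space m" for f g
  proof -
    obtain c d where cd: "f = R_star m c" "c \<in> l2 (J m)" "g = R_star m d" "d \<in> l2 (J m)"
      using f g unfolding bergman_space_eq by blast
    then have "(\<lambda>p. c p + d p) \<in> l2 (J m)" by (simp add: l2_J)
    then show ?thesis
      using R_R_star[of "\<lambda>p. c p + d p" m] by (simp only: cd R_star_add R_R_star)
  qed
  have cmult: "R m (\<lambda>x. k * f x) = (\<lambda>y. k * R m f y)" if f: "f \<in> bergman_space m" for f k
  proof -
    obtain c where c: "f = R_star m c" "c \<in> l2 (J m)"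
      using f unfolding bergman_space_eq by blast
    then have "(\<lambda>p. k * c p) \<in> l2 (J m)" by (simp add: l2_J)
    then show ?thesis
      using R_R_star[of "\<lambda>p. k * c p" m] by (simp only: c R_star_cmult R_R_star)
  qed
  have inner: "l2_inner (J m) (R m f) (R m g) = L2_inner (nu m) f g"
    if "f \<in> bergman_space m" "g \<in> bergman_space m" for f g
    using that by (auto simp: bergman_space_eq R_R_star L2_inner_R_star)
  show ?thesis
    unfolding isometric_isomorphism_def
    by (intro conjI allI ballI bij add cmult inner)
qed

lemma toeplitz_R_star:
  fixes a :: "complex ^ 'n \<Rightarrow> complex"
  assumes a: "a \<in> borel_measurable lebesgue" "bounded (range a)" "separately_radial a" and c: "c \<in>
      l2 (J m)"
  shows "toeplitz m a (R_star m c) = R_star m (mult_op (gamma a m) c)"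
proof -
  let ?f = "\<lambda>z. a z * R_star m c z"
  let ?e = "\<lambda>p :: nat ^ 'n. \<lambda>q. if q = p then 1 else 0 :: complex"
  \<comment> \<open>The error of a candidate \<open>R_star m e\<close> is paired with an arbitrary
    polynomial. The pairing vanishes for all \<open>d\<close> exactly when \<open>e\<close> agrees
    with \<open>mult_op (gamma a m) c\<close> on \<open>J m\<close>, which yields both existence and
    uniqueness of the projection.\<close>
  have inner: "L2_inner (nu m) (\<lambda>z. ?f z - R_star m e z) (R_star m d)
      = (\<Sum>p\<in>J m. (mult_op (gamma a m) c p - e p) * cnj (d p))" for e d
  proof -
    have "L2_inner (nu m) (\<lambda>z. ?f z - R_star m e z) (R_star m d)
        = (\<integral>z. a z * (R_star m c z * cnj (R_star m d z)) - R_star m e z * cnj (R_star m d z) \<partial>nu m)"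
      by (simp add: L2_inner_def algebra_simps)
    also have "\<dots> = (\<integral>z. a z * (R_star m c z
        * cnj (R_star m d z)) \<partial>nu m) - L2_inner (nu m) (R_star m e) (R_star m d)"
      unfolding L2_inner_def
      by (intro Bochner_Integration.integral_diff integrable_symbol_R_star integrable_R_star a)
    also have "\<dots> = (\<Sum>p\<in>J m. (mult_op (gamma a m) c p - e p) * cnj (d p))"
      by (simp add: integral_symbol_R_star[OF a] L2_inner_R_star l2_inner_J mult_op_def
          sum_subtractf algebra_simps)
    finally show ?thesis .
  qed
  \<comment> \<open>The projection is restricted to L2, so its description by \<open>THE\<close> is
    available only after this.\<close>
  have "?f \<in> L2 (nu m)"
  proof -
    have R: "R_star m c \<in> borel_measurable lebesgue"
      unfolding R_star_eq by (intro measurable_completion) simp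
    have meas: "(\<lambda>z. (cmod (a z))\<^sup>2) \<in> borel_measurable lebesgue"
      using a(1) by measurable
    \<comment> \<open>The squared modulus of \<open>a\<close> is itself a bounded measurable symbol.
      Its form at the pair \<open>c\<close>, \<open>c\<close> is the integral of the squared modulus
      of \<open>?f\<close>.\<close>
    then have "(\<lambda>z. complex_of_real ((cmod (a z))\<^sup>2)) \<in> borel_measurable lebesgue"
      by measurable
    moreover have "bounded (range (\<lambda>z. complex_of_real ((cmod (a z))\<^sup>2)))"
    proof -
      obtain K where "\<And>z. cmod (a z) \<le> K" using a(2) by (auto simp: bounded_iff)
      then have "(cmod (a z))\<^sup>2 \<le> K\<^sup>2" for z by (simp add: power_mono)
      then show ?thesis by (auto simp: bounded_iff norm_power intro!: exI[of _ "K\<^sup>2"])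
    qed
    ultimately have "integrable (nu m) (\<lambda>z. complex_of_real ((cmod (a z))\<^sup>2)
        * (R_star m c z * cnj (R_star m c z)))"
      by (rule integrable_symbol_R_star)
    then have "integrable (nu m) (\<lambda>z. complex_of_real ((cmod (?f z))\<^sup>2))"
      by (simp only: norm_mult power_mult_distrib of_real_mult complex_norm_square)
    then have "integrable (nu m) (\<lambda>z. (cmod (?f z))\<^sup>2)"
      by (rule complex_of_real_integrable_eq[THEN iffD1])
    then show ?thesis
      using a(1) R by (auto simp: L2_def measurable_nu_iff intro: borel_measurable_times)
  qed
  then have "toeplitz m a (R_star m c)
      = (THE g. g \<in> bergman_space m \<and> (\<forall>h\<in>bergman_space m. L2_inner (nu m) (\<lambda>z. ?f z - g z) h = 0))"
    by (simp add: toeplitz_def bergman_projection_def orthogonal_projection_def)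
  also have "\<dots> = R_star m (mult_op (gamma a m) c)"
  proof (rule the_equality)
    show "R_star m (mult_op (gamma a m) c) \<in> bergman_space m \<and>
        (\<forall>h\<in>bergman_space m. L2_inner (nu m) (\<lambda>z. ?f z - R_star m (mult_op (gamma a m) c) z) h = 0)"
      by (auto simp: bergman_space_eq inner mult_op_l2_J[OF c])
    fix g assume g: "g \<in> bergman_space m \<and> (\<forall>h\<in>bergman_space m. L2_inner (nu m) (\<lambda>z. ?f z - g z) h
        = 0)"
    then obtain e where e: "e \<in> l2 (J m)" "g = R_star m e" by (auto simp: bergman_space_eq)
    have "e p = mult_op (gamma a m) c p" for p
    proof (cases "p \<in> J m")
      case True
      \<comment> \<open>Testing against the normalized monomial \<open>R_star m (?e p)\<close>
        isolates the coefficient at \<open>p\<close>.\<close>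
      then have "?e p \<in> l2 (J m)" by (auto simp: l2_J)
      with g have "L2_inner (nu m) (\<lambda>z. ?f z - R_star m e z) (R_star m (?e p)) = 0"
        by (auto simp: bergman_space_eq e)
      with True show ?thesis
        by (simp add: inner if_distrib[of "\<lambda>x. _ * x"] if_distrib[of cnj] cong: if_cong)
    next
      case False
      then show ?thesis using e(1) c by (simp add: l2_J mult_op_def)
    qed
    then have "e = mult_op (gamma a m) c" by (rule ext)
    then show "g = R_star m (mult_op (gamma a m) c)" by (simp add: e(2))
  qed
  finally show ?thesis .
qed

theorem theorem5p5:
  fixes a :: "complex ^ 'n \<Rightarrow> complex" and m :: nat
  assumes "a \<in> borel_measurable lebesgue"
    and "bounded (range a)"
    and "separately_radial a"
  shows
    "isometric_isomorphism (bergman_space m) (L2_inner (nu m)) (l2 (J m)) (l2_inner (J m))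
       (R m :: (complex ^ 'n \<Rightarrow> complex) \<Rightarrow> (nat ^ 'n \<Rightarrow> complex)) \<and>
     isometric_isomorphism (l2 (J m)) (l2_inner (J m)) (bergman_space m) (L2_inner (nu m))
       (R_star m :: (nat ^ 'n \<Rightarrow> complex) \<Rightarrow> (complex ^ 'n \<Rightarrow> complex)) \<and>
     (\<forall>\<psi> \<in> (bergman_space m :: (complex ^ 'n \<Rightarrow> complex) set). R_star m (R m \<psi>) = \<psi>) \<and>
     (\<forall>c \<in> l2 (J m :: (nat ^ 'n) set). R m (R_star m c) = c) \<and>
     (\<forall>c \<in> l2 (J m). R m (toeplitz m a (R_star m c)) = mult_op (gamma a m) c) \<and>
     unitarily_equivalent
       (bergman_space m) (L2_inner (nu m)) (toeplitz m a)
       (l2 (J m)) (l2_inner (J m)) (mult_op (gamma a m))"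
proof -
  have T: "R m (toeplitz m a (R_star m c)) = mult_op (gamma a m) c" if "c \<in> l2 (J m)" for c
    using that by (simp add: toeplitz_R_star[OF assms] R_R_star mult_op_l2_J)
  have "unitarily_equivalent
       (bergman_space m) (L2_inner (nu m)) (toeplitz m a)
       (l2 (J m)) (l2_inner (J m)) (mult_op (gamma a m))"
    unfolding unitarily_equivalent_def
  proof (intro conjI exI[of _ "R m"] isometric_isomorphism_R ballI)
    show "toeplitz m a \<in> bergman_space m \<rightarrow> bergman_space m"
      by (auto simp: bergman_space_eq toeplitz_R_star[OF assms] mult_op_l2_J)
    show "mult_op (gamma a m) \<in> l2 (J m) \<rightarrow> l2 (J m)"
      by (auto simp: mult_op_l2_J)
    fix \<psi> :: "complex ^ 'n \<Rightarrow> complex" assume "\<psi> \<in> bergman_space m"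
    then show "R m (toeplitz m a \<psi>) = mult_op (gamma a m) (R m \<psi>)"
      by (auto simp: bergman_space_eq T R_R_star)
  qed
  then show ?thesis
    by (auto simp: isometric_isomorphism_R isometric_isomorphism_R_star R_star_R R_R_star T)
qed

end
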